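(* Let $(W,I)$ be a right-angled Coxeter system with $I$ finite, and let $X$ be a thick, semi-regular, locally finite building of type $(W,I)$. Assume that $(W,I)$ is irreducible and non-spherical. Then $\mathrm{Aut}(X)^+$ admits locally normal subgroups which decompose non-trivially as direct products, all of whose factors are themselves locally normal.
   Context: A Coxeter system $(W,I)$ with Coxeter matrix $(m_{i,j})$ is right-angled if $m_{i,j}\in\{2,\infty\}$ for all $i\neq j$. It is irreducible if $I$ is non-empty and is not the union of two disjoint non-empty subsets commuting elementwise; it is non-spherical if $W$ is infinite. A building $X$ of type $(W,I)$ is viewed as a set of chambers $\mathrm{Ch}(X)$ with a Weyl distance $\delta$. It is semi-regular if for each $i\in I$ all $i$-panels have the same cardinality $q_i$; thick if $q_i>2$ for all $i$; locally finite if $q_i<\infty$ for all $i$. $\mathrm{Aut}(X)^+$ is the group of type-preserving automorphisms (the $\delta$-preserving permutations of $\mathrm{Ch}(X)$), endowed with the topology of pointwise convergence on the discrete set $\mathrm{Ch}(X)$; it is a totally disconnected locally compact group. A locally normal subgroup of a locally compact group is a compact subgroup whose normaliser is open. A direct product decomposition is non-trivial if it has at least two factors and all factors are non-trivial. *)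

theory Defs
  imports "HOL-Analysis.Analysis" "HOL-Algebra.Algebra" "HOL-Library.Extended_Nat"
begin

definition coxeter_matrix :: "'i set \<Rightarrow> ('i \<Rightarrow> 'i \<Rightarrow> enat) \<Rightarrow> bool" where
  "coxeter_matrix I m \<longleftrightarrow>
     (\<forall>i\<in>I. m i i = 1) \<and>
     (\<forall>i\<in>I. \<forall>j\<in>I. m i j = m j i) \<and>
     (\<forall>i\<in>I. \<forall>j\<in>I. i \<noteq> j \<longrightarrow> 2 \<le> m i j)"

text \<open>
  The congruence on words over \<open>I\<close> generated by the Coxeter relations \<open>(i j)\<^sup>k = 1\<close>
  with \<open>k = m i j\<close> finite.  The case \<open>i = j\<close> contributes \<open>i i = 1\<close>, so every letter is
  invertible and the monoid presented in this way is the group presented by the same relations.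
\<close>

inductive coxeter_cong :: "'i set \<Rightarrow> ('i \<Rightarrow> 'i \<Rightarrow> enat) \<Rightarrow> 'i list \<Rightarrow> 'i list \<Rightarrow> bool"
  for I m where
  refl: "coxeter_cong I m u u"
| sym: "coxeter_cong I m u v \<Longrightarrow> coxeter_cong I m v u"
| trans: "coxeter_cong I m u v \<Longrightarrow> coxeter_cong I m v w \<Longrightarrow> coxeter_cong I m u w"
| relator: "i \<in> I \<Longrightarrow> j \<in> I \<Longrightarrow> m i j = enat k \<Longrightarrow>
    coxeter_cong I m (u @ concat (replicate k [i, j]) @ v) (u @ v)"

definition word_value :: "('w, 'b) monoid_scheme \<Rightarrow> ('i \<Rightarrow> 'w) \<Rightarrow> 'i list \<Rightarrow> 'w" where
  "word_value W r u = foldr (\<lambda>i w. r i \<otimes>\<^bsub>W\<^esub> w) u \<one>\<^bsub>W\<^esub>"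

text \<open>
  \<open>W\<close> is the group with generators \<open>r i\<close> (\<open>i \<in> I\<close>) presented by the Coxeter matrix \<open>m\<close>:
  two words have the same value exactly if the relations identify them.
\<close>

locale coxeter_system = group W
  for W :: "('w, 'b) monoid_scheme" (structure)
    and I :: "'i set" and m :: "'i \<Rightarrow> 'i \<Rightarrow> enat" and r :: "'i \<Rightarrow> 'w" +
  assumes coxeter_matrix: "coxeter_matrix I m"
    and gen_closed: "r \<in> I \<rightarrow> carrier W"
    and generated: "carrier W = word_value W r ` lists I"
    and presented: "u \<in> lists I \<Longrightarrow> v \<in> lists I \<Longrightarrow>
      word_value W r u = word_value W r v \<longleftrightarrow> coxeter_cong I m u v"

definition right_angled :: "'i set \<Rightarrow> ('i \<Rightarrow> 'i \<Rightarrow> enat) \<Rightarrow> bool" where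
  "right_angled I m \<longleftrightarrow> (\<forall>i\<in>I. \<forall>j\<in>I. i \<noteq> j \<longrightarrow> m i j \<in> {2, \<infinity>})"

definition irreducible_system ::
    "('w, 'b) monoid_scheme \<Rightarrow> 'i set \<Rightarrow> ('i \<Rightarrow> 'w) \<Rightarrow> bool" where
  "irreducible_system W I r \<longleftrightarrow> I \<noteq> {} \<and>
     \<not> (\<exists>J K. I = J \<union> K \<and> J \<inter> K = {} \<and> J \<noteq> {} \<and> K \<noteq> {} \<and>
          (\<forall>j\<in>J. \<forall>k\<in>K. r j \<otimes>\<^bsub>W\<^esub> r k = r k \<otimes>\<^bsub>W\<^esub> r j))"

definition non_spherical :: "('w, 'b) monoid_scheme \<Rightarrow> bool" where
  "non_spherical W \<longleftrightarrow> infinite (carrier W)"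

definition word_length ::
    "('w, 'b) monoid_scheme \<Rightarrow> 'i set \<Rightarrow> ('i \<Rightarrow> 'w) \<Rightarrow> 'w \<Rightarrow> nat" where
  "word_length W I r w = (LEAST n. \<exists>u\<in>lists I. length u = n \<and> word_value W r u = w)"

text \<open>
  The axioms of a \<open>W\<close>-metric space in the sense of Abramenko and Brown: \<open>dist_one_iff\<close> is (WD1),
  \<open>dist_step\<close> and \<open>dist_step_up\<close> are the two halves of (WD2), and \<open>dist_extend\<close> is (WD3).
\<close>

locale building = coxeter_system W I m r
  for W :: "('w, 'b) monoid_scheme" (structure)
    and I :: "'i set" and m :: "'i \<Rightarrow> 'i \<Rightarrow> enat" and r :: "'i \<Rightarrow> 'w" +
  fixes Ch :: "'c set" and \<delta> :: "'c \<Rightarrow> 'c \<Rightarrow> 'w"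
  assumes chambers_nonempty: "Ch \<noteq> {}"
    and dist_closed: "c \<in> Ch \<Longrightarrow> d \<in> Ch \<Longrightarrow> \<delta> c d \<in> carrier W"
    and dist_one_iff: "c \<in> Ch \<Longrightarrow> d \<in> Ch \<Longrightarrow> \<delta> c d = \<one> \<longleftrightarrow> c = d"
    and dist_step: "c \<in> Ch \<Longrightarrow> d \<in> Ch \<Longrightarrow> c' \<in> Ch \<Longrightarrow> i \<in> I \<Longrightarrow> \<delta> c' c = r i \<Longrightarrow>
      \<delta> c' d \<in> {r i \<otimes> \<delta> c d, \<delta> c d}"
    and dist_step_up: "c \<in> Ch \<Longrightarrow> d \<in> Ch \<Longrightarrow> c' \<in> Ch \<Longrightarrow> i \<in> I \<Longrightarrow> \<delta> c' c = r i \<Longrightarrow>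
      word_length W I r (r i \<otimes> \<delta> c d) = word_length W I r (\<delta> c d) + 1 \<Longrightarrow>
      \<delta> c' d = r i \<otimes> \<delta> c d"
    and dist_extend: "c \<in> Ch \<Longrightarrow> d \<in> Ch \<Longrightarrow> i \<in> I \<Longrightarrow>
      \<exists>c'\<in>Ch. \<delta> c' c = r i \<and> \<delta> c' d = r i \<otimes> \<delta> c d"

definition panel :: "('w, 'b) monoid_scheme \<Rightarrow> ('i \<Rightarrow> 'w) \<Rightarrow> 'c set \<Rightarrow> ('c \<Rightarrow> 'c \<Rightarrow> 'w) \<Rightarrow>
    'i \<Rightarrow> 'c \<Rightarrow> 'c set" where
  "panel W r Ch \<delta> i c = {d \<in> Ch. \<delta> c d \<in> {\<one>\<^bsub>W\<^esub>, r i}}"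

text \<open>
  Every \<open>i\<close>-panel is the panel of one of its chambers, so quantifying over chambers is
  quantifying over panels.
\<close>

definition semi_regular_building :: "('w, 'b) monoid_scheme \<Rightarrow> 'i set \<Rightarrow> ('i \<Rightarrow> 'w) \<Rightarrow>
    'c set \<Rightarrow> ('c \<Rightarrow> 'c \<Rightarrow> 'w) \<Rightarrow> bool" where
  "semi_regular_building W I r Ch \<delta> \<longleftrightarrow>
     (\<forall>i\<in>I. \<forall>c\<in>Ch. \<forall>d\<in>Ch. panel W r Ch \<delta> i c \<approx> panel W r Ch \<delta> i d)"

definition thick_building :: "('w, 'b) monoid_scheme \<Rightarrow> 'i set \<Rightarrow> ('i \<Rightarrow> 'w) \<Rightarrow>
    'c set \<Rightarrow> ('c \<Rightarrow> 'c \<Rightarrow> 'w) \<Rightarrow> bool" where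
  "thick_building W I r Ch \<delta> \<longleftrightarrow>
     (\<forall>i\<in>I. \<forall>c\<in>Ch. infinite (panel W r Ch \<delta> i c) \<or> card (panel W r Ch \<delta> i c) > 2)"

definition locally_finite_building :: "('w, 'b) monoid_scheme \<Rightarrow> 'i set \<Rightarrow> ('i \<Rightarrow> 'w) \<Rightarrow>
    'c set \<Rightarrow> ('c \<Rightarrow> 'c \<Rightarrow> 'w) \<Rightarrow> bool" where
  "locally_finite_building W I r Ch \<delta> \<longleftrightarrow>
     (\<forall>i\<in>I. \<forall>c\<in>Ch. finite (panel W r Ch \<delta> i c))"

definition type_pres_auts :: "'c set \<Rightarrow> ('c \<Rightarrow> 'c \<Rightarrow> 'w) \<Rightarrow> ('c \<Rightarrow> 'c) set" where
  "type_pres_auts Ch \<delta> = {g \<in> Bij Ch. \<forall>c\<in>Ch. \<forall>d\<in>Ch. \<delta> (g c) (g d) = \<delta> c d}"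

definition AutPlus :: "'c set \<Rightarrow> ('c \<Rightarrow> 'c \<Rightarrow> 'w) \<Rightarrow> ('c \<Rightarrow> 'c) monoid" where
  "AutPlus Ch \<delta> = BijGroup Ch \<lparr>carrier := type_pres_auts Ch \<delta>\<rparr>"

text \<open>
  Elements of \<^const>\<open>Bij\<close> are extensional, so the automorphisms form a subset of the
  space \<open>Ch \<rightarrow>\<^sub>E Ch\<close> underlying the product topology.
\<close>

definition AutPlus_topology :: "'c set \<Rightarrow> ('c \<Rightarrow> 'c \<Rightarrow> 'w) \<Rightarrow> ('c \<Rightarrow> 'c) topology" where
  "AutPlus_topology Ch \<delta> =
     subtopology (product_topology (\<lambda>_. discrete_topology Ch) Ch) (type_pres_auts Ch \<delta>)"

definition locally_normal :: "('g, 'b) monoid_scheme \<Rightarrow> 'g topology \<Rightarrow> 'g set \<Rightarrow> bool" where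
  "locally_normal G T H \<longleftrightarrow>
     subgroup H G \<and> compactin T H \<and> openin T (normalizer G H)"

text \<open>
  The internal direct product of a finite family of subgroups.  For a finite family of compact
  subgroups of a Hausdorff topological group the algebraic decomposition is also a topological
  one, since the multiplication map is a continuous bijection from a compact space.
\<close>

definition internal_direct_product ::
    "('g, 'b) monoid_scheme \<Rightarrow> 'g set \<Rightarrow> 'j set \<Rightarrow> ('j \<Rightarrow> 'g set) \<Rightarrow> bool" where
  "internal_direct_product G K J H \<longleftrightarrow> finite J \<and> subgroup K G \<and>
     (\<forall>j\<in>J. H j \<lhd> G\<lparr>carrier := K\<rparr>) \<and>
     generate G (\<Union>j\<in>J. H j) = K \<and>
     (\<forall>j\<in>J. H j \<inter> generate G (\<Union>k\<in>J - {j}. H k) = {\<one>\<^bsub>G\<^esub>})"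

definition nontrivial_direct_decomposition ::
    "('g, 'b) monoid_scheme \<Rightarrow> 'g set \<Rightarrow> 'j set \<Rightarrow> ('j \<Rightarrow> 'g set) \<Rightarrow> bool" where
  "nontrivial_direct_decomposition G K J H \<longleftrightarrow>
     internal_direct_product G K J H \<and> 2 \<le> card J \<and> (\<forall>j\<in>J. H j \<noteq> {\<one>\<^bsub>G\<^esub>})"

end

theory Submission
  imports Defs
begin

text \<open>
  Fix a chamber \<open>c\<close> and two generators \<open>i\<close>, \<open>j\<close> that do not commute; irreducibility and
  infiniteness of \<open>W\<close> provide them.  For a generator \<open>k\<close>, the \<^emph>\<open>wings\<close> of type \<open>k\<close> at \<open>c\<close> are
  made of the chambers \<open>x\<close> for which \<open>\<delta> x c\<close> has a reduced expression ending in \<open>k\<close>: these are the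
  chambers whose projection to the \<open>k\<close>-panel of \<open>c\<close> is not \<open>c\<close>.  Let \<open>V\<^sub>k\<close> be the group of
  automorphisms fixing every chamber outside these wings.  It is compact, because it fixes \<open>c\<close> and
  spheres around \<open>c\<close> are finite, and it is normalised by the stabiliser of \<open>c\<close>, which is open.
  In a right-angled Coxeter group two generators that end reduced expressions of one element commute
  (\<open>rdesc_commute\<close>), so the wings of type \<open>i\<close> and those of type \<open>j\<close> are disjoint.  Hence \<open>V\<^sub>i\<close> and
  \<open>V\<^sub>j\<close> commute and intersect trivially, and \<open>V\<^sub>i V\<^sub>j\<close> is the required locally normal subgroup.

  What has to be shown is that \<open>V\<^sub>j\<close> is not trivial (\<open>ex_wing_automorphism\<close>), that is, that some
  automorphism moves chambers in the wings only.  For this the chambers are given coordinates.  A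
  \<^emph>\<open>colouring\<close> assigns to each chamber a colour for each type \<open>k\<close>, such that the \<open>k\<close>-colour is
  bijective on \<open>k\<close>-panels, does not change along panels whose type commutes with \<open>k\<close>, and takes a
  distinguished value at the chamber of the panel nearest to \<open>c\<close>.  Semi-regularity and the
  product structure of the residues of type \<open>k \<union> k\<^sup>\<bottom>\<close> give a colouring (\<open>ex_colouring\<close>).  Any two
  colourings are related by an automorphism fixing \<open>c\<close> (\<open>colouring_transport\<close>): a chamber is reached
  from \<open>c\<close> by a minimal gallery, and following the colours of that gallery with respect to the other
  colouring leads to its image.  The image does not depend on the gallery, because two minimal
  galleries with the same ends differ by exchanging steps of commuting types, and such steps span
  squares.  Now exchange two colours, both different from the distinguished one, on the \<open>j\<close>-panels
  parallel to the panel of \<open>c\<close>; here thickness is used.  The resulting automorphism is not the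
  identity, while a minimal gallery from \<open>c\<close> to a chamber outside the wings meets no exchanged
  colour, so that such a chamber is fixed.

  The facts about \<open>W\<close> that enter are derived from the presentation.  The number of times, modulo 2,
  that a reflection occurs among the reflections attached to a word depends on the value of the word
  only; this yields the exchange condition.  Together with a homomorphism onto the infinite
  dihedral group it gives the commutation of descents.
\<close>

section \<open>Words and length in right-angled Coxeter groups\<close>

(* Words are treated through membership in lists I, rather than elementwise. *)
declare in_lists_conv_set [simp del]

locale right_angled_coxeter_system = coxeter_system W I m r
  for W :: "('w, 'b) monoid_scheme" (structure)
    and I :: "'i set" and m :: "'i \<Rightarrow> 'i \<Rightarrow> enat" and r :: "'i \<Rightarrow> 'w" +
  assumes right_angled: "right_angled I m"
begin

abbreviation val :: "'i list \<Rightarrow> 'w" where "val \<equiv> word_value W r"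
abbreviation len :: "'w \<Rightarrow> nat" where "len \<equiv> word_length W I r"

lemma gen_in [simp]: "i \<in> I \<Longrightarrow> r i \<in> carrier W"
  using gen_closed by auto

lemma val_Nil [simp]: "val [] = \<one>"
  by (simp add: word_value_def)

lemma val_Cons [simp]: "val (i # u) = r i \<otimes> val u"
  by (simp add: word_value_def)

lemma val_in [simp]: "u \<in> lists I \<Longrightarrow> val u \<in> carrier W"
  by (induction u) auto

lemma val_append: "u \<in> lists I \<Longrightarrow> v \<in> lists I \<Longrightarrow> val (u @ v) = val u \<otimes> val v"
  by (induction u) (auto simp: m_assoc)

lemma m_self: "i \<in> I \<Longrightarrow> m i i = enat 1"
  using coxeter_matrix by (auto simp: coxeter_matrix_def one_enat_def)

lemma m_commute: "i \<in> I \<Longrightarrow> j \<in> I \<Longrightarrow> m i j = m j i"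
  using coxeter_matrix by (auto simp: coxeter_matrix_def)

lemma m_cases:
  assumes "i \<in> I" "j \<in> I"
  obtains "i = j" | "i \<noteq> j" "m i j = 2" | "i \<noteq> j" "m i j = \<infinity>"
proof -
  have "i \<noteq> j \<longrightarrow> m i j \<in> {2, \<infinity>}" using assms right_angled by (simp add: right_angled_def)
  then show ?thesis using that by (cases "i = j") (simp, fastforce)
qed

lemma relator_cases:
  assumes "i \<in> I" "j \<in> I" "m i j = enat k"
  obtains "i = j" "concat (replicate k [i, j]) = [i, i]"
  | "i \<noteq> j" "m i j = 2" "concat (replicate k [i, j]) = [i, j, i, j]"
proof (cases rule: m_cases[OF assms(1,2)])
  case 1
  then have "enat k = enat 1" using m_self[OF assms(1)] assms(3) by metis
  then have "k = 1" by blast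
  then show ?thesis using 1 that(1) by simp
next
  case 2
  then have "enat k = enat 2" using assms(3) by (metis numeral_eq_enat)
  then have "k = 2" by blast
  then show ?thesis using 2 that(2) by (simp add: numeral_2_eq_2)
next
  case 3
  then show ?thesis using assms(3) by (metis enat.distinct(2))
qed

lemma gen_sq [simp]: "i \<in> I \<Longrightarrow> r i \<otimes> r i = \<one>"
  using presented[of "[i, i]" "[]"] coxeter_cong.relator[of i I i m 1 "[]" "[]"] m_self
  by simp

lemma gen_cancel [simp]: "i \<in> I \<Longrightarrow> w \<in> carrier W \<Longrightarrow> r i \<otimes> (r i \<otimes> w) = w"
  by (metis gen_in gen_sq l_one m_assoc)

lemma gen_commute: "i \<in> I \<Longrightarrow> j \<in> I \<Longrightarrow> m i j = 2 \<Longrightarrow> r i \<otimes> r j = r j \<otimes> r i"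
proof -
  assume ij: "i \<in> I" "j \<in> I" "m i j = 2"
  have "coxeter_cong I m ([] @ concat (replicate 2 [i, j]) @ []) ([] @ [])"
    using ij by (intro coxeter_cong.relator) (auto simp only: numeral_eq_enat)
  then have "coxeter_cong I m [i, j, i, j] []"
    unfolding numeral_2_eq_2 by simp
  then have "val [i, j, i, j] = val []"
    using presented[of "[i, j, i, j]" "[]"] ij(1,2) by simp
  then have "r i \<otimes> (r j \<otimes> (r i \<otimes> r j)) = \<one>"
    using ij(1,2) by simp
  then have "r j \<otimes> (r i \<otimes> (r i \<otimes> (r j \<otimes> (r i \<otimes> r j)))) = r j \<otimes> r i"
    using ij by simp
  then show ?thesis using ij by simp
qed

lemma gen_commute_assoc: "i \<in> I \<Longrightarrow> j \<in> I \<Longrightarrow> m i j = 2 \<Longrightarrow> w \<in> carrier W \<Longrightarrow>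
    r i \<otimes> (r j \<otimes> w) = r j \<otimes> (r i \<otimes> w)"
  by (metis gen_commute gen_in m_assoc)

lemma cong_lists: "coxeter_cong I m u v \<Longrightarrow> u \<in> lists I \<longleftrightarrow> v \<in> lists I"
proof (induction rule: coxeter_cong.induct)
  case (relator i j k u v)
  from relator show ?case by (cases rule: relator_cases) (simp_all add: relator(1,2))
qed auto

text \<open>
  In the right-angled case the defining relations only insert or delete a square \<open>i i\<close> or a
  commutator \<open>i j i j\<close>.  All invariants of group elements below are obtained by checking these two
  moves on words.
\<close>

lemma cong_invariant:
  assumes sq: "\<And>i u v. i \<in> I \<Longrightarrow> u \<in> lists I \<Longrightarrow> v \<in> lists I \<Longrightarrow> P (u @ [i, i] @ v) = P (u @ v)"
    and comm: "\<And>i j u v. i \<in> I \<Longrightarrow> j \<in> I \<Longrightarrow> i \<noteq> j \<Longrightarrow> m i j = 2 \<Longrightarrow> u \<in> lists I \<Longrightarrow>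
      v \<in> lists I \<Longrightarrow> P (u @ [i, j, i, j] @ v) = P (u @ v)"
    and uv: "u \<in> lists I" "v \<in> lists I" "val u = val v"
  shows "P u = P v"
proof -
  have "coxeter_cong I m u v" using presented uv by blast
  then show ?thesis using uv(1)
  proof (induction rule: coxeter_cong.induct)
    case (relator i j k u v)
    from relator(1-3) show ?case
      by (cases rule: relator_cases) (use relator sq[of i u v] comm[of i j u v] in auto)
  qed (auto simp: cong_lists)
qed

lemma count_parity:
  assumes "u \<in> lists I" "v \<in> lists I" "val u = val v"
  shows "even (count_list u k) = even (count_list v k)"
  by (rule cong_invariant[OF _ _ assms, where P = "\<lambda>u. even (count_list u k)"]) auto

lemma length_parity:
  assumes "u \<in> lists I" "v \<in> lists I" "val u = val v"
  shows "even (length u) = even (length v)"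
  by (rule cong_invariant[OF _ _ assms, where P = "\<lambda>u. even (length u)"]) auto

lemma gen_neq: "i \<in> I \<Longrightarrow> j \<in> I \<Longrightarrow> i \<noteq> j \<Longrightarrow> r i \<noteq> r j"
  using count_parity[of "[i]" "[j]" i] by auto

lemma gen_inj: "i \<in> I \<Longrightarrow> j \<in> I \<Longrightarrow> r i = r j \<longleftrightarrow> i = j"
  using gen_neq by auto

lemma gen_neq_one [simp]: "i \<in> I \<Longrightarrow> r i \<noteq> \<one>"
  using count_parity[of "[i]" "[]" i] by auto

lemma inv_gen [simp]: "i \<in> I \<Longrightarrow> inv (r i) = r i"
  by (simp add: inv_equality)

lemma len_le: "u \<in> lists I \<Longrightarrow> len (val u) \<le> length u"
  unfolding word_length_def by (rule Least_le) auto

lemma reduced_word: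
  assumes "w \<in> carrier W"
  obtains u where "u \<in> lists I" "val u = w" "length u = len w"
proof -
  have "\<exists>n. \<exists>u\<in>lists I. length u = n \<and> val u = w"
    using assms by (metis generated imageE)
  from LeastI_ex[OF this] show ?thesis using that unfolding word_length_def by auto
qed

lemma len_one [simp]: "len \<one> = 0"
  using len_le[of "[]"] by simp

lemma len_mult_le: "i \<in> I \<Longrightarrow> w \<in> carrier W \<Longrightarrow> len (r i \<otimes> w) \<le> Suc (len w)"
proof -
  assume *: "i \<in> I" "w \<in> carrier W"
  obtain u where u: "u \<in> lists I" "val u = w" "length u = len w"
    using reduced_word * by blast
  then show ?thesis using len_le[of "i # u"] * by simp
qed

lemma len_mult_parity:
  assumes "i \<in> I" "w \<in> carrier W"
  shows "even (len (r i \<otimes> w)) \<longleftrightarrow> odd (len w)"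
proof -
  obtain u where u: "u \<in> lists I" "val u = w" "length u = len w"
    using reduced_word assms by blast
  obtain v where v: "v \<in> lists I" "val v = r i \<otimes> w" "length v = len (r i \<otimes> w)"
    using reduced_word assms by (metis gen_in m_closed)
  show ?thesis using length_parity[of "i # u" v] u v assms by auto
qed

lemma len_mult_cases:
  assumes "i \<in> I" "w \<in> carrier W"
  shows "len (r i \<otimes> w) = Suc (len w) \<or> len w = Suc (len (r i \<otimes> w))"
proof -
  have "len (r i \<otimes> w) \<le> Suc (len w)" "len w \<le> Suc (len (r i \<otimes> w))"
    using len_mult_le[OF assms] len_mult_le[of i "r i \<otimes> w"] assms by auto
  then show ?thesis using len_mult_parity[OF assms]
    by (metis le_antisym not_less_eq_eq)
qed

definition desc :: "'i \<Rightarrow> 'w \<Rightarrow> bool" where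
  "desc i w \<longleftrightarrow> len (r i \<otimes> w) < len w"

lemma desc_len: "i \<in> I \<Longrightarrow> w \<in> carrier W \<Longrightarrow> desc i w \<Longrightarrow> len w = Suc (len (r i \<otimes> w))"
  using len_mult_cases[of i w] by (auto simp: desc_def)

lemma not_desc_len: "i \<in> I \<Longrightarrow> w \<in> carrier W \<Longrightarrow> \<not> desc i w \<Longrightarrow> len (r i \<otimes> w) = Suc (len w)"
  using len_mult_cases[of i w] by (auto simp: desc_def)

lemma desc_mult: "i \<in> I \<Longrightarrow> w \<in> carrier W \<Longrightarrow> desc i (r i \<otimes> w) \<longleftrightarrow> \<not> desc i w"
  using len_mult_cases[of i w] by (auto simp: desc_def)

lemma not_desc_one [simp]: "\<not> desc i \<one>"
  by (simp add: desc_def)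

lemma ex_desc:
  assumes "w \<in> carrier W" "w \<noteq> \<one>"
  obtains i where "i \<in> I" "desc i w"
proof -
  obtain u where u: "u \<in> lists I" "val u = w" "length u = len w"
    using reduced_word assms by blast
  then obtain i v where "u = i # v" using assms by (cases u) auto
  then have i: "i \<in> I" and v: "v \<in> lists I" "length v < len w" and w: "w = r i \<otimes> val v"
    using u by auto
  have "r i \<otimes> w = val v" using i w val_in[OF v(1)] by simp
  then show ?thesis using that i v len_le[of v] by (simp add: desc_def)
qed

section \<open>Reflections and the exchange condition\<close>

definition conj_gen :: "'i \<Rightarrow> 'w \<Rightarrow> 'w" where
  "conj_gen i t = r i \<otimes> t \<otimes> r i"

lemma conj_gen_in [simp]: "i \<in> I \<Longrightarrow> t \<in> carrier W \<Longrightarrow> conj_gen i t \<in> carrier W"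
  by (simp add: conj_gen_def)

lemma conj_gen_conj_gen [simp]:
  "i \<in> I \<Longrightarrow> t \<in> carrier W \<Longrightarrow> conj_gen i (conj_gen i t) = t"
  by (simp add: conj_gen_def m_assoc)

lemma conj_gen_eq_iff:
  "i \<in> I \<Longrightarrow> s \<in> carrier W \<Longrightarrow> t \<in> carrier W \<Longrightarrow> conj_gen i s = t \<longleftrightarrow> s = conj_gen i t"
  using conj_gen_conj_gen by metis

lemma conj_gen_self [simp]: "i \<in> I \<Longrightarrow> conj_gen i (r i) = r i"
  by (simp add: conj_gen_def)

lemma conj_gen_perp: "i \<in> I \<Longrightarrow> j \<in> I \<Longrightarrow> m i j = 2 \<Longrightarrow> conj_gen i (r j) = r j"
  using gen_commute[of i j] by (simp add: conj_gen_def m_assoc)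

lemma conj_gen_commute:
  "i \<in> I \<Longrightarrow> j \<in> I \<Longrightarrow> m i j = 2 \<Longrightarrow> t \<in> carrier W \<Longrightarrow>
    conj_gen i (conj_gen j t) = conj_gen j (conj_gen i t)"
  using gen_commute_assoc[of i j "t \<otimes> (r j \<otimes> r i)"] gen_commute[of i j]
  by (simp add: conj_gen_def m_assoc)

text \<open>
  For \<open>u = i\<^sub>1 \<dots> i\<^sub>n\<close> these are the reflections \<open>i\<^sub>1 \<dots> i\<^sub>k \<dots> i\<^sub>1\<close>; multiplying the value of \<open>u\<close> by
  one of them from the left deletes the letter \<open>i\<^sub>k\<close>.
\<close>

fun reflections :: "'i list \<Rightarrow> 'w list" where
  "reflections [] = []"
| "reflections (i # u) = r i # map (conj_gen i) (reflections u)"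

lemma reflections_in: "u \<in> lists I \<Longrightarrow> set (reflections u) \<subseteq> carrier W"
  by (induction u) auto

lemma count_map_conj_gen:
  assumes "i \<in> I" "set ts \<subseteq> carrier W" "t \<in> carrier W"
  shows "count_list (map (conj_gen i) ts) t = count_list ts (conj_gen i t)"
  using assms(2) by (induction ts) (use assms conj_gen_eq_iff in auto)

lemma count_reflections_Cons:
  assumes "i \<in> I" "u \<in> lists I" "t \<in> carrier W"
  shows "count_list (reflections (i # u)) t = of_bool (t = r i) + count_list (reflections u) (conj_gen i t)"
  using count_map_conj_gen[OF assms(1) reflections_in[OF assms(2)] assms(3)] by auto

lemma reflections_parity_append:
  assumes "u \<in> lists I" "t \<in> carrier W" "v \<in> lists I" "v' \<in> lists I"
    and "\<And>t. t \<in> carrier W \<Longrightarrow> even (count_list (reflections v) t) = even (count_list (reflections v') t)"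
  shows "even (count_list (reflections (u @ v)) t) = even (count_list (reflections (u @ v')) t)"
  using assms(1,2)
proof (induction u arbitrary: t)
  case (Cons i u)
  then show ?case using assms(3,4) by (simp del: reflections.simps add: count_reflections_Cons)
qed (use assms in auto)

text \<open>
  A square contributes one reflection twice, and a commutator of commuting \<open>i\<close>, \<open>j\<close> contributes
  each of \<open>i\<close> and \<open>j\<close> twice.
\<close>

lemma reflections_parity:
  assumes "u \<in> lists I" "v \<in> lists I" "val u = val v" and t: "t \<in> carrier W"
  shows "even (count_list (reflections u) t) = even (count_list (reflections v) t)"
proof (rule cong_invariant[OF _ _ assms(1-3), where P = "\<lambda>u. even (count_list (reflections u) t)"])
  fix i u v assume *: "i \<in> I" "u \<in> lists I" "v \<in> lists I"
  have "even (count_list (reflections ([i, i] @ v)) t) = even (count_list (reflections v) t)"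
    if t: "t \<in> carrier W" for t
  proof -
    have "conj_gen i t = r i \<longleftrightarrow> t = r i" using * t by (simp add: conj_gen_eq_iff)
    then show ?thesis using * t by (simp del: reflections.simps add: count_reflections_Cons)
  qed
  then show "even (count_list (reflections (u @ [i, i] @ v)) t) = even (count_list (reflections (u @ v)) t)"
    using * t by (intro reflections_parity_append) auto
next
  fix i j u v
  assume *: "i \<in> I" "j \<in> I" "i \<noteq> j" "m i j = 2" "u \<in> lists I" "v \<in> lists I"
  then have *: "m j i = 2" "i \<in> I" "j \<in> I" "i \<noteq> j" "m i j = 2" "u \<in> lists I" "v \<in> lists I"
    using m_commute by auto
  have "even (count_list (reflections ([i, j, i, j] @ v)) t) = even (count_list (reflections v) t)"
    if t: "t \<in> carrier W" for t
  proof -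
    have "conj_gen i t = r j \<longleftrightarrow> t = r j" "conj_gen j (conj_gen i t) = r i \<longleftrightarrow> t = r i"
      "conj_gen i (conj_gen j (conj_gen i t)) = conj_gen j t"
      "conj_gen j t = r j \<longleftrightarrow> t = r j"
      using * t by (simp_all add: conj_gen_eq_iff conj_gen_perp conj_gen_commute[of i j])
    then show ?thesis using * t by (simp del: reflections.simps add: count_reflections_Cons)
  qed
  then show "even (count_list (reflections (u @ [i, j, i, j] @ v)) t) = even (count_list (reflections (u @ v)) t)"
    using * t by (intro reflections_parity_append) auto
qed

lemma reflections_delete:
  assumes "u \<in> lists I" "t \<in> set (reflections u)"
  shows "\<exists>u1 k u2. u = u1 @ k # u2 \<and> t \<otimes> val u = val (u1 @ u2)"
  using assms
proof (induction u arbitrary: t)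
  case (Cons i u)
  show ?case
  proof (cases "t = r i")
    case True
    then have "i # u = [] @ i # u \<and> t \<otimes> val (i # u) = val ([] @ u)" using Cons by auto
    then show ?thesis by blast
  next
    case False
    then obtain s where s: "s \<in> set (reflections u)" "t = conj_gen i s" using Cons by auto
    then obtain u1 k u2 where u: "u = u1 @ k # u2" "s \<otimes> val u = val (u1 @ u2)"
      using Cons by (metis Cons_in_lists_iff)
    have "s \<in> carrier W" using s reflections_in Cons by auto
    then have "t \<otimes> val (i # u) = val ((i # u1) @ u2)"
      using u(2) s Cons by (simp add: conj_gen_def m_assoc)
    then show ?thesis using u(1) by (metis append_Cons)
  qed
qed auto

text \<open>
  If \<open>v\<close> is reduced and \<open>i v\<close> is longer than \<open>v\<close>, then \<open>i\<close> is not among the reflections of \<open>v\<close>, since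
  it would delete a letter.  So it occurs exactly once for the word \<open>i v\<close>, and hence an odd number of
  times for every other word with that value.
\<close>

lemma exchange:
  assumes "i \<in> I" "u \<in> lists I" "desc i (val u)"
  obtains u1 k u2 where "u = u1 @ k # u2" "r i \<otimes> val u = val (u1 @ u2)"
proof -
  obtain v where v: "v \<in> lists I" "val v = r i \<otimes> val u" "length v = len (r i \<otimes> val u)"
    using reduced_word[of "r i \<otimes> val u"] assms by auto
  have "r i \<notin> set (reflections v)"
  proof
    assume "r i \<in> set (reflections v)"
    then obtain v1 k v2 where v': "v = v1 @ k # v2" "r i \<otimes> val v = val (v1 @ v2)"
      using reflections_delete v(1) by blast
    then have "val u = val (v1 @ v2)" using v assms by simp
    then have "len (val u) \<le> length (v1 @ v2)" using len_le[of "v1 @ v2"] v v' by auto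
    then show False using v(3) v'(1) assms(3) by (simp add: desc_def)
  qed
  then have "count_list (reflections v) (r i) = 0" by (simp add: count_list_0_iff)
  then have "odd (count_list (reflections (i # v)) (r i))"
    using v(1) assms by (simp del: reflections.simps add: count_reflections_Cons)
  moreover have "val (i # v) = val u" using v assms by simp
  ultimately have "odd (count_list (reflections u) (r i))"
    using reflections_parity[of "i # v" u "r i"] v assms by auto
  then have "r i \<in> set (reflections u)" by (metis count_list_0_iff even_zero)
  then show ?thesis using reflections_delete assms that by blast
qed

section \<open>Commutation of descents\<close>

fun alternating :: "nat \<Rightarrow> 'i \<Rightarrow> 'i \<Rightarrow> 'i list" where
  "alternating 0 i j = []"
| "alternating (Suc n) i j = i # alternating n j i"

lemma length_alternating [simp]: "length (alternating n i j) = n"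
  by (induction n i j rule: alternating.induct) auto

lemma alternating_in [simp]: "i \<in> I \<Longrightarrow> j \<in> I \<Longrightarrow> alternating n i j \<in> lists I"
  by (induction n i j rule: alternating.induct) auto

text \<open>
  The infinite dihedral group acts on \<open>\<int>\<close>, with \<open>i\<close> and \<open>j\<close> acting as the reflections that exchange
  \<open>0\<close> with \<open>- 1\<close> and \<open>0\<close> with \<open>1\<close>.  Letting all other letters act trivially extends this to \<open>W\<close>
  whenever \<open>m i j = \<infinity>\<close>, and the image of \<open>0\<close> measures the length of alternating words.
\<close>

fun dihedral :: "'i \<Rightarrow> 'i \<Rightarrow> 'i list \<Rightarrow> int \<Rightarrow> int" where
  "dihedral i j [] x = x"
| "dihedral i j (k # u) x = (if k = i then - 1 - dihedral i j u x else if k = j then 1 - dihedral i j u x else dihedral i j u x)"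

lemma dihedral_append: "dihedral i j (u @ v) x = dihedral i j u (dihedral i j v x)"
  by (induction u) auto

lemma dihedral_cong:
  assumes "i \<in> I" "j \<in> I" "m i j = \<infinity>" "u \<in> lists I" "v \<in> lists I" "val u = val v"
  shows "dihedral i j u = dihedral i j v"
proof (rule cong_invariant[OF _ _ assms(4-6), where P = "dihedral i j"])
  fix k l u v
  assume *: "k \<in> I" "l \<in> I" "k \<noteq> l" "m k l = 2"
  then have "{k, l} \<noteq> {i, j}" using assms m_commute by (auto simp: doubleton_eq_iff)
  then show "dihedral i j (u @ [k, l, k, l] @ v) = dihedral i j (u @ v)"
    using * by (auto simp: dihedral_append fun_eq_iff)
qed (auto simp: dihedral_append fun_eq_iff)

lemma dihedral_le: "\<bar>dihedral i j u 0\<bar> \<le> int (length u)"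
  by (induction u) auto

lemma dihedral_alternating: "i \<noteq> j \<Longrightarrow> dihedral i j (alternating n i j) 0 = - int n \<and> dihedral i j (alternating n j i) 0 = int n"
  by (induction n) auto

lemma alternating_reduced:
  assumes "i \<in> I" "j \<in> I" "i \<noteq> j" "m i j = \<infinity>" "u \<in> lists I" "val u = val (alternating n i j)"
  shows "n \<le> length u"
  using dihedral_cong[of i j u "alternating n i j"] dihedral_le[of i j u] dihedral_alternating[of i j n] assms by auto

text \<open>
  Prepend one letter at a time: exchange with the letter missing at the front cannot delete inside
  the alternating prefix, as that would shorten an alternating word.  The conclusion for large
  \<open>n\<close> is absurd, so it excludes two descents \<open>i\<close>, \<open>j\<close> with \<open>m i j = \<infinity>\<close>.
\<close>

lemma alternating_expression:
  assumes "i \<in> I" "j \<in> I" "i \<noteq> j" "m i j = \<infinity>" "w \<in> carrier W" "desc i w" "desc j w"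
  shows "\<exists>v\<in>lists I. w = val (alternating n i j @ v) \<and> n + length v = len w"
  using assms
proof (induction n arbitrary: i j)
  case 0
  then show ?case using reduced_word[of w] by (metis add_0 alternating.simps(1) append_Nil)
next
  case (Suc n)
  have "m j i = \<infinity>" using Suc.prems m_commute by auto
  then obtain v where v: "v \<in> lists I" "w = val (alternating n j i @ v)" "n + length v = len w"
    using Suc.IH[of j i] Suc.prems by auto
  obtain u1 k u2 where u: "alternating n j i @ v = u1 @ k # u2" "r i \<otimes> w = val (u1 @ u2)"
    using exchange[of i "alternating n j i @ v"] v Suc.prems by auto
  have in_I: "u1 \<in> lists I" "u2 \<in> lists I" "k \<in> I"
    using u(1) v(1) alternating_in[of j i n] Suc.prems(1,2)
    by (metis append_in_lists_conv Cons_in_lists_iff)+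
  then have w: "w = r i \<otimes> val (u1 @ u2)"
    using u(2) Suc.prems by (metis gen_cancel)
  consider (L) us where "alternating n j i = u1 @ k # us" "u2 = us @ v"
    | (R) us where "u1 = alternating n j i @ us" "v = us @ k # u2"
  proof -
    from u(1) obtain us where
      "alternating n j i = u1 @ us \<and> us @ v = k # u2 \<or> alternating n j i @ us = u1 \<and> v = us @ k # u2"
      by (auto simp: append_eq_append_conv2)
    then show thesis using L R by (cases us) auto
  qed
  then show ?case
  proof cases
    case L
    have us: "us \<in> lists I" using in_I L by auto
    have "val (u1 @ us) \<otimes> val v = val (u1 @ u2)"
      using us in_I(1) v(1) L(2) by (simp add: val_append m_assoc)
    also have "\<dots> = r i \<otimes> val (alternating n j i @ v)" using u(2) v(2) by simp
    also have "\<dots> = val (alternating (Suc n) i j) \<otimes> val v"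
      using v(1) Suc.prems(1,2) by (simp add: val_append m_assoc)
    finally have "val (u1 @ us) = val (alternating (Suc n) i j)"
      using us in_I(1) v(1) Suc.prems(1,2) by (simp del: val_Cons alternating.simps add: alternating_in)
    from alternating_reduced[OF Suc.prems(1-4) _ this] have "Suc n \<le> length (u1 @ us)"
      using us in_I by auto
    moreover have "n = Suc (length (u1 @ us))" using L(1) by (metis length_alternating add_Suc_right length_Cons length_append)
    ultimately show ?thesis by simp
  next
    case R
    then have "w = val (alternating (Suc n) i j @ (us @ u2))" using w by simp
    then show ?thesis using R v in_I by (intro bexI[of _ "us @ u2"]) auto
  qed
qed

lemma desc_commute:
  assumes "i \<in> I" "j \<in> I" "i \<noteq> j" "w \<in> carrier W" "desc i w" "desc j w"
  shows "m i j = 2"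
  using assms(1,2)
proof (cases rule: m_cases)
  case 3
  then show ?thesis using alternating_expression[OF assms(1-3) _ assms(4-6), of "Suc (len w)"] by auto
qed (use assms in auto)

lemma desc_other:
  assumes "i \<in> I" "j \<in> I" "i \<noteq> j" "w \<in> carrier W" "desc i w" "desc j w"
  shows "desc i (r j \<otimes> w)"
proof -
  obtain v where v: "v \<in> lists I" "val v = r j \<otimes> w" "length v = len (r j \<otimes> w)"
    using reduced_word[of "r j \<otimes> w"] assms by auto
  have w: "w = val (j # v)" using v assms by simp
  obtain u1 k u2 where u: "j # v = u1 @ k # u2" "r i \<otimes> val (j # v) = val (u1 @ u2)"
    using exchange[of i "j # v"] assms(1,2,5) v(1) unfolding w by (metis Cons_in_lists_iff)
  show ?thesis
  proof (cases u1)
    case Nil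
    then have "r i \<otimes> w = r j \<otimes> w" using u v(2) unfolding w by simp
    then have "r i = r j" using assms by simp
    then show ?thesis using assms gen_inj by blast
  next
    case (Cons l u1')
    then have l: "l = j" "v = u1' @ k # u2" using u by auto
    then have "r i \<otimes> w = r j \<otimes> val (u1' @ u2)" using u(2) Cons unfolding w by simp
    moreover have "r i \<otimes> (r j \<otimes> w) = r j \<otimes> (r i \<otimes> w)"
      using gen_commute_assoc desc_commute assms by metis
    ultimately have "r i \<otimes> (r j \<otimes> w) = val (u1' @ u2)" using assms v l by simp
    then have "len (r i \<otimes> (r j \<otimes> w)) \<le> length (u1' @ u2)"
      using len_le[of "u1' @ u2"] v l by simp
    then show ?thesis using v l by (simp add: desc_def)
  qed
qed

text \<open>
  Multiplication by \<open>r j\<close> from the left preserves the wall of the reflection \<open>r i\<close> together with both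
  of its sides, and \<open>i\<close> is a descent of \<open>w\<close> exactly if this wall separates \<open>w\<close> from \<open>\<one>\<close>.
\<close>

lemma desc_perp:
  assumes "i \<in> I" "j \<in> I" "i \<noteq> j" "m i j = 2" "w \<in> carrier W"
  shows "desc i (r j \<otimes> w) \<longleftrightarrow> desc i w"
proof -
  have *: "desc i (r j \<otimes> w)" if "w \<in> carrier W" "desc i w" for w
  proof (cases "desc j w")
    case True
    then show ?thesis using desc_other assms that by blast
  next
    case False
    have "len (r i \<otimes> (r j \<otimes> w)) = len (r j \<otimes> (r i \<otimes> w))"
      using gen_commute_assoc assms that by metis
    also have "\<dots> \<le> Suc (len (r i \<otimes> w))" using len_mult_le assms that by simp
    also have "\<dots> = len w" using desc_len assms that by simp
    also have "\<dots> < len (r j \<otimes> w)" using not_desc_len[of j w] False assms that by simp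
    finally show ?thesis by (simp add: desc_def)
  qed
  show ?thesis using *[of w] *[of "r j \<otimes> w"] assms by auto
qed

lemma rev_in [simp]: "rev u \<in> lists I \<longleftrightarrow> u \<in> lists I"
  by (simp add: in_lists_conv_set)

lemma val_rev: "u \<in> lists I \<Longrightarrow> val (rev u) = inv (val u)"
  by (induction u) (simp_all add: val_append inv_mult_group)

lemma len_inv:
  assumes "w \<in> carrier W"
  shows "len (inv w) = len w"
proof -
  have *: "len (inv w) \<le> len w" if "w \<in> carrier W" for w
  proof -
    obtain u where u: "u \<in> lists I" "val u = w" "length u = len w"
      using reduced_word[OF \<open>w \<in> carrier W\<close>] by blast
    then show ?thesis using len_le[of "rev u"] by (simp add: val_rev)
  qed
  show ?thesis using *[of w] *[of "inv w"] assms by simp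
qed

definition rdesc :: "'i \<Rightarrow> 'w \<Rightarrow> bool" where
  "rdesc i w \<longleftrightarrow> len (w \<otimes> r i) < len w"

lemma rdesc_inv: "i \<in> I \<Longrightarrow> w \<in> carrier W \<Longrightarrow> rdesc i w \<longleftrightarrow> desc i (inv w)"
  using len_inv[of "w \<otimes> r i"] len_inv[of w] by (simp add: rdesc_def desc_def inv_mult_group)

lemma rdesc_commute:
  assumes "i \<in> I" "j \<in> I" "i \<noteq> j" "w \<in> carrier W" "rdesc i w" "rdesc j w"
  shows "m i j = 2"
  using desc_commute[of i j "inv w"] assms by (simp add: rdesc_inv)

lemma rdesc_one [simp]: "\<not> rdesc i \<one>"
  by (simp add: rdesc_def)

lemma rdesc_up:
  assumes "i \<in> I" "k \<in> I" "w \<in> carrier W" "\<not> desc k w" "rdesc i w"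
  shows "rdesc i (r k \<otimes> w)"
proof -
  have "len (r k \<otimes> w \<otimes> r i) \<le> Suc (len (w \<otimes> r i))"
    using len_mult_le[of k "w \<otimes> r i"] assms(1-3) by (simp add: m_assoc)
  also have "\<dots> < Suc (len w)" using assms(5) by (simp add: rdesc_def)
  also have "\<dots> = len (r k \<otimes> w)" using not_desc_len assms by simp
  finally show ?thesis by (simp add: rdesc_def)
qed

lemma rdesc_central:
  assumes "i \<in> I" "w \<in> carrier W" "desc i w" "r i \<otimes> w = w \<otimes> r i"
  shows "rdesc i w"
  using assms by (simp add: rdesc_def desc_def)

end

section \<open>Adjacency of chambers\<close>

locale right_angled_building =
  building W I m r Ch \<delta> + right_angled_coxeter_system W I m r
  for W :: "('w, 'b) monoid_scheme" (structure)
    and I :: "'i set" and m :: "'i \<Rightarrow> 'i \<Rightarrow> enat" and r :: "'i \<Rightarrow> 'w"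
    and Ch :: "'c set" and \<delta> :: "'c \<Rightarrow> 'c \<Rightarrow> 'w"
begin

definition adj :: "'i \<Rightarrow> 'c \<Rightarrow> 'c \<Rightarrow> bool" where
  "adj k x y \<longleftrightarrow> x \<in> Ch \<and> y \<in> Ch \<and> \<delta> x y \<in> {\<one>, r k}"

lemma panel_eq: "x \<in> Ch \<Longrightarrow> panel W r Ch \<delta> k x = {y. adj k x y}"
  by (auto simp: panel_def adj_def)

lemma dist_self [simp]: "x \<in> Ch \<Longrightarrow> \<delta> x x = \<one>"
  using dist_one_iff by blast

lemma adj_in: "adj k x y \<Longrightarrow> x \<in> Ch" "adj k x y \<Longrightarrow> y \<in> Ch"
  by (auto simp: adj_def)

lemma adj_refl [simp]: "adj k x x \<longleftrightarrow> x \<in> Ch"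
  by (auto simp: adj_def)

lemma adj_dist: "adj k x y \<Longrightarrow> x \<noteq> y \<Longrightarrow> \<delta> x y = r k"
  using dist_one_iff by (auto simp: adj_def)

lemma adj_step:
  assumes "k \<in> I" "adj k x y" "z \<in> Ch"
  shows "\<delta> x z = r k \<otimes> \<delta> y z \<or> \<delta> x z = \<delta> y z"
proof (cases "x = y")
  case False
  then show ?thesis using dist_step[of y z x k] adj_dist[of k x y] assms adj_in[of k x y] by blast
qed auto

lemma adj_sym: "k \<in> I \<Longrightarrow> adj k x y \<Longrightarrow> adj k y x"
proof -
  assume *: "k \<in> I" "adj k x y"
  then have in_Ch: "x \<in> Ch" "y \<in> Ch" using adj_in by auto
  show ?thesis
  proof (cases "x = y")
    case False
    then have "\<one> = r k \<otimes> \<delta> y x" using adj_step[OF * in_Ch(1)] in_Ch dist_one_iff by force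
    then have "\<delta> y x = r k" using * in_Ch dist_closed by (metis gen_cancel gen_in r_one)
    then show ?thesis using in_Ch by (simp add: adj_def)
  qed (use in_Ch in auto)
qed

lemma adj_trans: "k \<in> I \<Longrightarrow> adj k x y \<Longrightarrow> adj k y z \<Longrightarrow> adj k x z"
  using adj_step[of k x y z] by (auto simp: adj_def)

lemma adj_types:
  assumes "k \<in> I" "l \<in> I" "k \<noteq> l" "adj k x y" "adj l x y"
  shows "x = y"
  using adj_dist[of k x y] adj_dist[of l x y] gen_inj assms by metis

text \<open>
  Residues of type \<open>{k, l}\<close> with commuting \<open>k\<close> and \<open>l\<close> are products of a \<open>k\<close>-panel and an \<open>l\<close>-panel.
\<close>

lemma square:
  assumes "k \<in> I" "l \<in> I" "m k l = 2" "adj k x y" "adj l y z"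
  obtains u where "adj l x u" "adj k u z"
proof (cases "x = y \<or> y = z")
  case True
  then show ?thesis using that[of z] that[of x] assms adj_in by auto
next
  case False
  have in_Ch: "x \<in> Ch" "y \<in> Ch" "z \<in> Ch" using assms adj_in by auto
  have kl: "k \<noteq> l" using assms m_self by (auto simp: numeral_eq_enat)
  have yz: "\<delta> y z = r l" using adj_dist False assms by blast
  have "\<delta> x z \<noteq> r l"
  proof
    assume "\<delta> x z = r l"
    then have "adj l x z" using in_Ch by (simp add: adj_def)
    then have "adj l x y" using adj_trans adj_sym assms by blast
    then show False using adj_types[of k l x y] assms kl False by auto
  qed
  then have xz: "\<delta> x z = r k \<otimes> r l" using adj_step[OF assms(1,4) in_Ch(3)] yz \<open>\<delta> x z \<noteq> r l\<close> by auto
  obtain u where u: "u \<in> Ch" "\<delta> u x = r l" "\<delta> u z = r l \<otimes> \<delta> x z"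
    using dist_extend in_Ch assms by blast
  have "\<delta> u z = r l \<otimes> (r l \<otimes> r k)" using u(3) xz gen_commute[OF assms(1-3)] by metis
  then have "\<delta> u z = r k" using assms(1,2) by simp
  then have "adj k u z" using u in_Ch by (simp add: adj_def)
  moreover have "adj l u x" using u(1,2) in_Ch by (simp add: adj_def)
  then have "adj l x u" using adj_sym assms(2) by blast
  ultimately show ?thesis using that by blast
qed

lemma perp_neq: "k \<in> I \<Longrightarrow> m k l = 2 \<Longrightarrow> k \<noteq> l"
  using m_self by (auto simp: numeral_eq_enat)

text \<open>
  Going from \<open>x\<close> towards \<open>y\<close> along a minimal gallery, the distance grows by one generator at each
  step backwards, and this is forced for the images as well.
\<close>

lemma dist_preserving:
  assumes h: "h \<in> Ch \<rightarrow> Ch" "inj_on h Ch" "\<And>k x y. k \<in> I \<Longrightarrow> adj k x y \<Longrightarrow> adj k (h x) (h y)"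
    and "x \<in> Ch" "y \<in> Ch"
  shows "\<delta> (h x) (h y) = \<delta> x y"
  using assms(4)
proof (induction "len (\<delta> x y)" arbitrary: x rule: less_induct)
  case less
  show ?case
  proof (cases "\<delta> x y = \<one>")
    case True
    then show ?thesis using less.prems assms dist_one_iff by (metis PiE)
  next
    case False
    then obtain k where k: "k \<in> I" "desc k (\<delta> x y)"
      using ex_desc dist_closed less.prems assms by metis
    obtain z where z: "z \<in> Ch" "\<delta> z x = r k" "\<delta> z y = r k \<otimes> \<delta> x y"
      using dist_extend less.prems assms k by blast
    have "len (\<delta> z y) < len (\<delta> x y)" using k z by (simp add: desc_def)
    then have IH: "\<delta> (h z) (h y) = \<delta> z y" using less.hyps z by blast
    have "adj k z x" using z less.prems by (simp add: adj_def)
    then have xz: "adj k x z" "x \<noteq> z"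
      using adj_sym z(2) less.prems k(1) gen_neq_one[OF k(1)] dist_self by metis+
    have hin: "h x \<in> Ch" "h y \<in> Ch" "h z \<in> Ch" using h(1) less.prems assms z by auto
    have "h x \<noteq> h z" using xz h(2) less.prems z by (auto dest: inj_onD)
    then have hxz: "\<delta> (h x) (h z) = r k" using adj_dist h(3) xz k by blast
    have xy: "r k \<otimes> \<delta> z y = \<delta> x y" using z less.prems assms dist_closed k by simp
    have "len (r k \<otimes> \<delta> z y) = len (\<delta> z y) + 1"
      unfolding xy using desc_len[of k "\<delta> x y"] k z less.prems assms dist_closed by simp
    then have "\<delta> (h x) (h y) = r k \<otimes> \<delta> (h z) (h y)"
      using dist_step_up[of "h z" "h y" "h x" k] hin k hxz IH by simp
    then show ?thesis using IH xy by simp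
  qed
qed

end

section \<open>Chambers seen from a root chamber\<close>

lemma pointed_bij:
  assumes "A \<approx> B" "a \<in> A" "b \<in> B"
  shows "\<exists>f. bij_betw f A B \<and> f a = b"
proof -
  obtain f where f: "bij_betw f A B" using assms(1) by (auto simp: eqpoll_def)
  then have "f a \<in> B" using assms by (auto simp: bij_betw_def)
  then have "bij_betw (Transposition.transpose (f a) b \<circ> f) A B"
    using f assms(3) by (intro bij_betw_trans[OF f]) (auto simp: Transposition.transpose_def bij_betw_def inj_on_def image_iff split: if_splits)
  then show ?thesis by (intro exI[of _ "Transposition.transpose (f a) b \<circ> f"]) auto
qed

locale rooted_building = right_angled_building W I m r Ch \<delta>
  for W :: "('w, 'b) monoid_scheme" (structure)
    and I :: "'i set" and m :: "'i \<Rightarrow> 'i \<Rightarrow> enat" and r :: "'i \<Rightarrow> 'w"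
    and Ch :: "'c set" and \<delta> :: "'c \<Rightarrow> 'c \<Rightarrow> 'w" +
  fixes c :: 'c
  assumes root_in [simp]: "c \<in> Ch"
begin

abbreviation descends :: "'i \<Rightarrow> 'c \<Rightarrow> bool" where
  "descends k x \<equiv> desc k (\<delta> x c)"

lemma root_dist_in [simp]: "x \<in> Ch \<Longrightarrow> \<delta> x c \<in> carrier W"
  by (simp add: dist_closed)

lemma adj_up:
  assumes "k \<in> I" "adj k x y" "\<not> descends k y" "x \<noteq> y"
  shows "\<delta> x c = r k \<otimes> \<delta> y c" "descends k x"
proof -
  have "x \<in> Ch" "y \<in> Ch" using assms adj_in by auto
  then show *: "\<delta> x c = r k \<otimes> \<delta> y c"
    using dist_step_up[of y c x k] adj_dist[of k x y] assms not_desc_len by simp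
  show "descends k x" unfolding * using desc_mult \<open>y \<in> Ch\<close> assms by simp
qed

lemma adj_not_descends_unique: "k \<in> I \<Longrightarrow> adj k x y \<Longrightarrow> \<not> descends k x \<Longrightarrow> \<not> descends k y \<Longrightarrow> x = y"
  using adj_up by blast

text \<open>
  The projection of the root to a panel of \<open>x\<close>, that is, the chamber of the panel nearest to the root.
\<close>

definition gate :: "'i \<Rightarrow> 'c \<Rightarrow> 'c" where
  "gate k x = (THE p. adj k x p \<and> \<not> descends k p)"

lemma gate_eqI:
  assumes "k \<in> I" "adj k x p" "\<not> descends k p"
  shows "gate k x = p"
  unfolding gate_def
  using assms adj_not_descends_unique adj_sym adj_trans by (intro the_equality) blast+

lemma gate:
  assumes "k \<in> I" "x \<in> Ch"
  shows adj_gate: "adj k x (gate k x)" and not_descends_gate: "\<not> descends k (gate k x)"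
proof -
  have "\<exists>p. adj k x p \<and> \<not> descends k p"
  proof (cases "descends k x")
    case True
    obtain p where p: "p \<in> Ch" "\<delta> p x = r k" "\<delta> p c = r k \<otimes> \<delta> x c"
      using dist_extend assms root_in by blast
    have "\<not> descends k p" unfolding p(3) using desc_mult True assms by simp
    moreover have "adj k p x" using p(1,2) assms by (simp add: adj_def)
    then have "adj k x p" using adj_sym assms(1) by blast
    ultimately show ?thesis by blast
  next
    case False
    then show ?thesis using adj_refl assms(2) by blast
  qed
  then show "adj k x (gate k x)" "\<not> descends k (gate k x)"
    using gate_eqI assms by auto
qed

lemma gate_in [simp]: "k \<in> I \<Longrightarrow> x \<in> Ch \<Longrightarrow> gate k x \<in> Ch"
  using adj_gate adj_in by blast

lemma gate_adj: "k \<in> I \<Longrightarrow> adj k x y \<Longrightarrow> gate k x = gate k y"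
  by (meson adj_gate adj_in adj_trans gate_eqI not_descends_gate)

lemma dist_gate:
  assumes "k \<in> I" "x \<in> Ch" "descends k x"
  shows "\<delta> x c = r k \<otimes> \<delta> (gate k x) c" "len (\<delta> (gate k x) c) < len (\<delta> x c)"
proof -
  have "x \<noteq> gate k x" using assms not_descends_gate by metis
  then show *: "\<delta> x c = r k \<otimes> \<delta> (gate k x) c"
    using adj_up adj_gate not_descends_gate assms by blast
  show "len (\<delta> (gate k x) c) < len (\<delta> x c)"
    unfolding * using not_desc_len[of k "\<delta> (gate k x) c"] not_descends_gate assms by simp
qed

lemma descends_perp:
  assumes "k \<in> I" "l \<in> I" "m k l = 2" "adj l x y"
  shows "descends k x \<longleftrightarrow> descends k y"
  using adj_step[of l x y c] desc_perp[of k l "\<delta> y c"] perp_neq assms adj_in[of l x y] by auto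

text \<open>
  Projection of the root is compatible with the parallelism of \<open>k\<close>-panels along commuting directions.
\<close>

lemma gate_perp:
  assumes "k \<in> I" "l \<in> I" "m k l = 2" "adj l x y"
  shows "adj l (gate k x) (gate k y)"
proof -
  have in_Ch: "x \<in> Ch" "y \<in> Ch" using assms adj_in by auto
  obtain u where u: "adj l (gate k x) u" "adj k u y"
    using square[of k l "gate k x" x y] assms in_Ch adj_sym adj_gate by blast
  have "\<not> descends k u" using descends_perp[of k l "gate k x" u] u assms not_descends_gate in_Ch by blast
  then have "gate k y = u" using gate_eqI adj_sym u assms by blast
  then show ?thesis using u by simp
qed

lemma at_root: "x \<in> Ch \<Longrightarrow> \<delta> x c = \<one> \<longleftrightarrow> x = c"
  using dist_one_iff by simp

lemma ex_descends:
  assumes "x \<in> Ch" "x \<noteq> c"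
  obtains k where "k \<in> I" "descends k x"
  using ex_desc[of "\<delta> x c"] assms at_root by auto

section \<open>Parallel panels and colourings\<close>

text \<open>
  Galleries all of whose types differ from \<open>k\<close> and commute with \<open>k\<close>.  They identify each
  \<open>k\<close>-panel with the \<open>k\<close>-panels parallel to it (\<open>par_square\<close>), and without monodromy (\<open>par_adj_eq\<close>).
\<close>

definition par :: "'i \<Rightarrow> 'c \<Rightarrow> 'c \<Rightarrow> bool" where
  "par k = (\<lambda>x y. \<exists>l\<in>I. m k l = 2 \<and> adj l x y)\<^sup>*\<^sup>*"

lemma par_refl [simp]: "par k x x"
  by (simp add: par_def)

lemma par_trans: "par k x y \<Longrightarrow> par k y z \<Longrightarrow> par k x z"
  unfolding par_def by (rule rtranclp_trans)

lemma par_sym: "par k x y \<Longrightarrow> par k y x"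
  unfolding par_def
proof (induction rule: rtranclp_induct)
  case (step y z)
  then obtain l where "l \<in> I" "m k l = 2" "adj l z y" using adj_sym by blast
  then show ?case using step by (intro converse_rtranclp_into_rtranclp[of _ z y]) auto
qed auto

lemma par_step: "l \<in> I \<Longrightarrow> m k l = 2 \<Longrightarrow> adj l x y \<Longrightarrow> par k x y"
  unfolding par_def by blast

lemma par_square:
  assumes "k \<in> I" "par k x y" "adj k y y'"
  shows "\<exists>x'. adj k x x' \<and> par k x' y'"
  using assms(2) unfolding par_def
proof (induction rule: converse_rtranclp_induct)
  case base
  then show ?case using assms by blast
next
  case (step w x)
  then obtain l x' where l: "l \<in> I" "m k l = 2" "adj l w x" "adj k x x'" "par k x' y'"
    by (auto simp: par_def)
  have "m l k = 2" using m_commute l assms by simp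
  then obtain w' where "adj k w w'" "adj l w' x'"
    using square[of l k w x x'] l assms by blast
  then show ?case using l par_step par_trans unfolding par_def[symmetric] by blast
qed

lemma par_descends:
  assumes "k \<in> I" "par k x y"
  shows "descends k x \<longleftrightarrow> descends k y"
  using assms(2) unfolding par_def
  by (induction rule: rtranclp_induct) (use descends_perp assms in blast)+

lemma par_dist:
  assumes "k \<in> I" "par k x y" "x \<in> Ch"
  shows "y \<in> Ch \<and> (\<exists>u\<in>lists {l\<in>I. m k l = 2}. \<delta> x y = val u)"
proof -
  have "x \<in> Ch \<longrightarrow> y \<in> Ch \<and> (\<exists>u\<in>lists {l\<in>I. m k l = 2}. \<delta> x y = val u)"
    using assms(2) unfolding par_def
  proof (induction rule: converse_rtranclp_induct)
    case base
    show ?case by (auto intro!: bexI[of _ "[]"])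
  next
    case (step w x)
    then obtain l where l: "l \<in> I" "m k l = 2" "adj l w x" by blast
    then have in_Ch: "w \<in> Ch" "x \<in> Ch" using adj_in by auto
    then obtain u where u: "y \<in> Ch" "u \<in> lists {l\<in>I. m k l = 2}" "\<delta> x y = val u"
      using step by blast
    then have "\<delta> w y = val (l # u) \<or> \<delta> w y = val u" using adj_step[OF l(1,3) u(1)] u(3) by simp
    moreover have "l # u \<in> lists {l\<in>I. m k l = 2}" using u l by simp
    ultimately show ?case using u by blast
  qed
  then show ?thesis using assms by blast
qed

text \<open>
  The distance of two chambers joined by such a gallery is a product of generators other than
  \<open>k\<close>, whereas the letter \<open>k\<close> occurs an odd number of times in every word for \<open>r k\<close>.
\<close>

lemma par_adj_eq:
  assumes "k \<in> I" "par k x y" "adj k x y"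
  shows "x = y"
proof (rule ccontr)
  assume "x \<noteq> y"
  then have "\<delta> x y = r k" using adj_dist assms by blast
  moreover obtain u where u: "u \<in> lists {l\<in>I. m k l = 2}" "\<delta> x y = val u"
    using par_dist[OF assms(1,2)] assms(3) adj_in by blast
  moreover have "u \<in> lists I" "k \<notin> set u"
    using u(1) perp_neq[OF assms(1), of k] by (auto simp: in_lists_conv_set)
  ultimately show False using count_parity[of "[k]" u k] assms(1)
    by (auto simp: count_list_0_iff[THEN iffD2])
qed

text \<open>
  The relation of lying in a common residue of type \<open>k \<union> k\<^sup>\<bottom>\<close>.
\<close>

definition wall :: "'i \<Rightarrow> 'c \<Rightarrow> 'c \<Rightarrow> bool" where
  "wall k x y \<longleftrightarrow> (\<exists>z. par k x z \<and> adj k z y)"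

lemma wall_refl: "x \<in> Ch \<Longrightarrow> wall k x x"
  unfolding wall_def by (metis adj_refl par_refl)

lemma adj_wall: "adj k x y \<Longrightarrow> wall k x y"
  unfolding wall_def using par_refl by blast

lemma wall_sym: "k \<in> I \<Longrightarrow> wall k x y \<Longrightarrow> wall k y x"
  unfolding wall_def by (meson adj_sym par_square par_sym)

lemma wall_trans: "k \<in> I \<Longrightarrow> wall k x y \<Longrightarrow> wall k y z \<Longrightarrow> wall k x z"
  unfolding wall_def by (meson adj_sym adj_trans par_square par_sym par_trans)

text \<open>
  One \<open>k\<close>-panel is selected in each residue of type \<open>k \<union> k\<^sup>\<bottom>\<close>, so that a bijection chosen on
  this panel can be carried to all panels parallel to it.
\<close>

definition base_chamber :: "'i \<Rightarrow> 'c \<Rightarrow> 'c" where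
  "base_chamber k x = (SOME y. wall k x y)"

lemma wall_base: "x \<in> Ch \<Longrightarrow> wall k x (base_chamber k x)"
  unfolding base_chamber_def using wall_refl by (rule someI)

lemma base_cong:
  assumes "k \<in> I" "wall k x y"
  shows "base_chamber k x = base_chamber k y"
proof -
  have "wall k x = wall k y" using assms wall_sym wall_trans by blast
  then show ?thesis by (simp add: base_chamber_def)
qed

text \<open>
  The projection of \<open>x\<close> to the selected panel.
\<close>

definition shadow :: "'i \<Rightarrow> 'c \<Rightarrow> 'c" where
  "shadow k x = (THE y. adj k (base_chamber k x) y \<and> par k x y)"

lemma shadow_eqI:
  assumes "k \<in> I" "adj k (base_chamber k x) y" "par k x y"
  shows "shadow k x = y"
  unfolding shadow_def
  by (rule the_equality) (use assms in \<open>meson adj_sym adj_trans par_adj_eq par_sym par_trans\<close>)+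

lemma shadow:
  assumes "k \<in> I" "x \<in> Ch"
  shows adj_shadow: "adj k (base_chamber k x) (shadow k x)" and par_shadow: "par k x (shadow k x)"
proof -
  obtain z where "par k x z" "adj k (base_chamber k x) z"
    using wall_base[OF assms(2)] adj_sym assms(1) unfolding wall_def by blast
  then show "adj k (base_chamber k x) (shadow k x)" "par k x (shadow k x)"
    using shadow_eqI assms by auto
qed

lemma shadow_par:
  assumes "k \<in> I" "x \<in> Ch" "y \<in> Ch" "par k x y"
  shows "base_chamber k x = base_chamber k y" "shadow k x = shadow k y"
proof -
  have "wall k x y" using assms unfolding wall_def by (metis adj_refl)
  then show *: "base_chamber k x = base_chamber k y" using base_cong assms by blast
  show "shadow k x = shadow k y"
    using shadow_eqI[of k x "shadow k y"] adj_shadow[of k y] par_shadow[of k y] assms *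
    by (metis par_trans)
qed

lemma bij_shadow:
  assumes "k \<in> I" "x \<in> Ch"
  shows "bij_betw (shadow k) {y. adj k x y} {y. adj k (base_chamber k x) y}"
proof -
  have base: "base_chamber k y = base_chamber k x" if "adj k x y" for y
    using base_cong adj_wall that assms by metis
  show ?thesis
  proof (rule bij_betw_imageI)
    show "inj_on (shadow k) {y. adj k x y}"
    proof (rule inj_onI)
      fix y z assume *: "y \<in> {y. adj k x y}" "z \<in> {y. adj k x y}" "shadow k y = shadow k z"
      then have "par k y z" using par_shadow assms adj_in by (metis mem_Collect_eq par_sym par_trans)
      moreover have "adj k y z" using * adj_sym adj_trans assms by blast
      ultimately show "y = z" using par_adj_eq assms by blast
    qed
    show "shadow k ` {y. adj k x y} = {y. adj k (base_chamber k x) y}"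
    proof (intro equalityI subsetI)
      fix z assume "z \<in> shadow k ` {y. adj k x y}"
      then show "z \<in> {y. adj k (base_chamber k x) y}"
        using adj_shadow base assms adj_in by fastforce
    next
      fix z assume "z \<in> {y. adj k (base_chamber k x) y}"
      then have z: "adj k (base_chamber k x) z" by blast
      then have "adj k (shadow k x) z" using adj_shadow assms adj_sym adj_trans by blast
      then obtain y where y: "adj k x y" "par k y z"
        using par_square par_shadow assms by blast
      then have "shadow k y = z"
        using shadow_eqI[OF assms(1), of y z] base[OF y(1)] z by simp
      then show "z \<in> shadow k ` {y. adj k x y}" using y by blast
    qed
  qed
qed

text \<open>
  Colours of type \<open>k\<close> are the chambers of the \<open>k\<close>-panel of the root; the root itself is the
  distinguished colour, which marks the chamber of a panel nearest to the root.
\<close>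

definition colouring :: "('i \<Rightarrow> 'c \<Rightarrow> 'c) \<Rightarrow> bool" where
  "colouring col \<longleftrightarrow>
     (\<forall>k\<in>I. \<forall>x\<in>Ch. bij_betw (col k) {y. adj k x y} {y. adj k c y}) \<and>
     (\<forall>k\<in>I. \<forall>l\<in>I. m k l = 2 \<longrightarrow> (\<forall>x y. adj l x y \<longrightarrow> col k x = col k y)) \<and>
     (\<forall>k\<in>I. \<forall>x\<in>Ch. col k x = c \<longleftrightarrow> \<not> descends k x)"

text \<open>
  The \<open>k\<close>-colour of a chamber is read off its shadow, by a bijection from the selected panel to the
  panel of the root that matches the chambers nearest to the root.
\<close>

lemma ex_colouring:
  assumes sr: "semi_regular_building W I r Ch \<delta>"
  shows "\<exists>col. colouring col"
proof -
  have "\<exists>f. bij_betw f {y. adj k z y} {y. adj k c y} \<and> f (gate k z) = c" if "k \<in> I" "z \<in> Ch" for k z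
    using sr that panel_eq adj_gate
    by (intro pointed_bij) (auto simp: semi_regular_building_def)
  then obtain f where f: "\<And>k z. k \<in> I \<Longrightarrow> z \<in> Ch \<Longrightarrow>
      bij_betw (f k z) {y. adj k z y} {y. adj k c y} \<and> f k z (gate k z) = c"
    by metis
  define col where "col k x = f k (base_chamber k x) (shadow k x)" for k x
  have base_in: "base_chamber k x \<in> Ch" if "k \<in> I" "x \<in> Ch" for k x
    using adj_shadow that adj_in by blast
  have "colouring col"
    unfolding colouring_def
  proof (intro conjI ballI allI impI)
    fix k x assume *: "k \<in> I" "x \<in> Ch"
    have "bij_betw (f k (base_chamber k x) \<circ> shadow k) {y. adj k x y} {y. adj k c y}"
      using bij_shadow f * base_in by (blast intro: bij_betw_trans)
    moreover have "(f k (base_chamber k x) \<circ> shadow k) y = col k y" if "y \<in> {y. adj k x y}" for y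
      using base_cong[OF *(1) adj_wall, of x y] that by (simp add: col_def)
    ultimately show "bij_betw (col k) {y. adj k x y} {y. adj k c y}"
      using bij_betw_cong[of "{y. adj k x y}"] by blast
  next
    fix k l x y assume *: "k \<in> I" "l \<in> I" "m k l = 2" "adj l x y"
    then have "par k x y" "x \<in> Ch" "y \<in> Ch" using par_step adj_in by auto
    then show "col k x = col k y" using shadow_par[of k x y] *(1) by (simp add: col_def)
  next
    fix k x assume *: "k \<in> I" "x \<in> Ch"
    let ?b = "base_chamber k x"
    have b: "?b \<in> Ch" using base_in * by blast
    have "col k x = c \<longleftrightarrow> f k ?b (shadow k x) = f k ?b (gate k ?b)"
      using f * b by (simp add: col_def)
    also have "\<dots> \<longleftrightarrow> shadow k x = gate k ?b"
      using f[OF *(1) b] adj_gate[OF *(1) b] adj_shadow[OF *]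
      by (auto simp: bij_betw_def dest: inj_onD)
    also have "\<dots> \<longleftrightarrow> \<not> descends k (shadow k x)"
      using gate_eqI[OF *(1) adj_shadow[OF *]] not_descends_gate[OF *(1) b] by metis
    also have "\<dots> \<longleftrightarrow> \<not> descends k x" using par_descends par_shadow * by blast
    finally show "col k x = c \<longleftrightarrow> \<not> descends k x" .
  qed
  then show ?thesis by blast
qed

section \<open>Automorphisms from pairs of colourings\<close>

text \<open>
  Both chambers move away from the root by steps of the same type and with matching colours.  The
  rules are symmetric in the two sides, so that injectivity and surjectivity of the resulting map are
  uniqueness and existence for the exchanged colourings.
\<close>

inductive follows :: "('i \<Rightarrow> 'c \<Rightarrow> 'c) \<Rightarrow> ('i \<Rightarrow> 'c \<Rightarrow> 'c) \<Rightarrow> 'c \<Rightarrow> 'c \<Rightarrow> bool"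
  for col col' where
  base: "follows col col' c c"
| step: "follows col col' x y \<Longrightarrow> k \<in> I \<Longrightarrow> adj k x x' \<Longrightarrow> adj k y y' \<Longrightarrow>
    \<not> descends k x \<Longrightarrow> \<not> descends k y \<Longrightarrow> x' \<noteq> x \<Longrightarrow> y' \<noteq> y \<Longrightarrow> col k x' = col' k y' \<Longrightarrow>
    follows col col' x' y'"

lemma follows_sym: "follows col col' x y \<Longrightarrow> follows col' col y x"
proof (induction rule: follows.induct)
  case (step x y k x' y')
  show ?case
    using follows.step[OF step.IH step.hyps(2,4,3,6,5,8,7)] step.hyps(9) by simp
qed (rule follows.base)

lemma follows_in: "follows col col' x y \<Longrightarrow> x \<in> Ch \<and> y \<in> Ch"
  by (induction rule: follows.induct) (auto dest: adj_in)

lemma follows_dist: "follows col col' x y \<Longrightarrow> \<delta> x c = \<delta> y c"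
proof (induction rule: follows.induct)
  case (step x y k x' y')
  then have "\<delta> x' c = r k \<otimes> \<delta> x c" "\<delta> y' c = r k \<otimes> \<delta> y c"
    using adj_up(1)[of k x' x] adj_up(1)[of k y' y] adj_sym by blast+
  then show ?case using step by simp
qed auto

lemma colouring_bij: "colouring col \<Longrightarrow> k \<in> I \<Longrightarrow> x \<in> Ch \<Longrightarrow>
    bij_betw (col k) {y. adj k x y} {y. adj k c y}"
  and colouring_perp: "colouring col \<Longrightarrow> k \<in> I \<Longrightarrow> l \<in> I \<Longrightarrow> m k l = 2 \<Longrightarrow> adj l x y \<Longrightarrow>
    col k x = col k y"
  and colouring_descends: "colouring col \<Longrightarrow> k \<in> I \<Longrightarrow> x \<in> Ch \<Longrightarrow> col k x = c \<longleftrightarrow> \<not> descends k x"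
  unfolding colouring_def by blast+

lemma colouring_inj:
  assumes "colouring col" "k \<in> I" "adj k x y" "col k x = col k y"
  shows "x = y"
  using colouring_bij[OF assms(1,2), of x] assms adj_in[of k x y]
  unfolding bij_betw_def inj_on_def by (metis adj_refl mem_Collect_eq)

lemma colouring_ex:
  assumes "colouring col" "k \<in> I" "x \<in> Ch" "adj k c a"
  obtains y where "adj k x y" "col k y = a"
proof -
  have "a \<in> col k ` {y. adj k x y}"
    using colouring_bij[OF assms(1-3)] assms(4) by (simp add: bij_betw_def)
  then show ?thesis using that by blast
qed

lemma colouring_in: "colouring col \<Longrightarrow> k \<in> I \<Longrightarrow> x \<in> Ch \<Longrightarrow> adj k c (col k x)"
  using colouring_bij[of col k x] unfolding bij_betw_def by (metis adj_refl imageI mem_Collect_eq)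

context
  fixes col col' :: "'i \<Rightarrow> 'c \<Rightarrow> 'c"
  assumes col: "colouring col" and col': "colouring col'"
begin

lemma follows_up:
  assumes "follows col col' x y" "k \<in> I" "adj k x x'" "adj k y y'" "\<not> descends k x" "x' \<noteq> x"
    "col k x' = col' k y'"
  shows "follows col col' x' y'"
proof -
  have y: "\<not> descends k y" using follows_dist[OF assms(1)] assms(5) by simp
  have "descends k x'" using adj_up(2)[of k x' x] adj_sym assms by blast
  then have "col k x' \<noteq> c" using colouring_descends[OF col, of k x'] assms adj_in by blast
  then have "descends k y'" using colouring_descends[OF col', of k y'] assms adj_in by metis
  then have "y' \<noteq> y" using y by blast
  then show ?thesis using follows.step assms y by blast
qed

text \<open>
  A step of type \<open>l\<close> away from the root preserves the \<open>k\<close>-colours for \<open>k\<close> commuting with \<open>l\<close>.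
  For the other types \<open>k \<noteq> l\<close> both sides receive the distinguished colour, because \<open>k\<close> and \<open>l\<close>
  cannot both be descents.
\<close>

lemma follows_col:
  assumes "follows col col' x y" "k \<in> I"
  shows "col k x = col' k y"
  using assms
proof (induction arbitrary: k rule: follows.induct)
  case base
  then show ?case using colouring_descends[OF col, of k c] colouring_descends[OF col', of k c] by simp
next
  case (step x y l x' y')
  have in_Ch: "x' \<in> Ch" "y' \<in> Ch" using step adj_in by blast+
  have l: "descends l x'" using adj_up(2)[of l x' x] adj_sym step by blast
  have eq: "\<delta> x' c = \<delta> y' c" using follows_dist follows.step[OF step.hyps] by blast
  show ?case
  proof (cases "k = l")
    case False
    show ?thesis
    proof (cases "m k l = 2")
      case True
      then show ?thesis
        using colouring_perp[OF col, of k l x x'] colouring_perp[OF col', of k l y y'] step by metis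
    next
      case nc: False
      then have "\<not> descends k x'"
        using desc_commute[of k l "\<delta> x' c"] l False step in_Ch by auto
      then show ?thesis
        using colouring_descends[OF col, of k x'] colouring_descends[OF col', of k y'] eq step.prems in_Ch by simp
    qed
  qed (use step in auto)
qed

lemma follows_total:
  assumes "x \<in> Ch"
  shows "\<exists>y. follows col col' x y"
  using assms
proof (induction "len (\<delta> x c)" arbitrary: x rule: less_induct)
  case less
  show ?case
  proof (cases "x = c")
    case True
    then show ?thesis using follows.base by blast
  next
    case False
    then obtain k where k: "k \<in> I" "descends k x" using ex_descends less.prems by blast
    obtain z where z: "follows col col' (gate k x) z"
      using less.hyps dist_gate(2) k less.prems by force
    then have "z \<in> Ch" using follows_in by blast
    then obtain y where y: "adj k z y" "col' k y = col k x"
      using colouring_ex[OF col' k(1)] colouring_in[OF col k(1) less.prems] by blast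
    have "adj k (gate k x) x" using adj_gate adj_sym k less.prems by blast
    moreover have "\<not> descends k (gate k x)" using not_descends_gate k less.prems by blast
    ultimately have "follows col col' x y" using follows_up[OF z k(1) _ y(1), of x] y(2) k(2) by metis
    then show ?thesis by blast
  qed
qed

text \<open>
  The relation is defined through some minimal gallery from the root; this lemma shows that every
  descent of \<open>x\<close> may be taken as its last step.  If the last step has type \<open>l \<noteq> k\<close>, then \<open>k\<close> and \<open>l\<close>
  commute, and the last two steps can be exchanged across the squares on both sides.
\<close>

lemma follows_gate:
  assumes "follows col col' x y" "k \<in> I"
  shows "follows col col' (gate k x) (gate k y)"
proof -
  have "descends k x \<Longrightarrow> follows col col' (gate k x) (gate k y)"
    using assms
  proof (induction rule: follows.induct)
    case (step x y l x' y')
    show ?case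
    proof (cases "k = l")
      case True
      then have "gate k x' = x" "gate k y' = y"
        using gate_eqI[of k x' x] gate_eqI[of k y' y] adj_sym step.hyps by blast+
      then show ?thesis using step.hyps(1) by simp
    next
      case False
      have in_Ch: "x \<in> Ch" "y \<in> Ch" "x' \<in> Ch" "y' \<in> Ch" using step adj_in by blast+
      have l: "descends l x'" using adj_up(2)[of l x' x] adj_sym step by blast
      have kl: "m k l = 2" "m l k = 2"
        using desc_commute[of k l "\<delta> x' c"] l False step in_Ch m_commute by auto
      have dnx: "descends k x" using descends_perp[of k l x x'] step kl by blast
      have IH: "follows col col' (gate k x) (gate k y)" using step dnx by blast
      have adjs: "adj l (gate k x) (gate k x')" "adj l (gate k y) (gate k y')"
        using gate_perp step kl by blast+
      have "\<not> descends l (gate k x)"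
        using descends_perp[of l k x "gate k x"] adj_gate[of k x] step kl in_Ch by blast
      moreover have "gate k x' \<noteq> gate k x"
      proof
        assume "gate k x' = gate k x"
        then have "adj k x' x" using adj_gate[of k x] adj_gate[of k x'] adj_sym adj_trans step in_Ch by metis
        then show False using adj_types[of k l x' x] step False adj_sym by blast
      qed
      moreover have "col l (gate k x') = col' l (gate k y')"
        using colouring_perp[OF col, of l k x' "gate k x'"] colouring_perp[OF col', of l k y' "gate k y'"]
          adj_gate in_Ch step kl by metis
      ultimately show ?thesis using follows_up[OF IH \<open>l \<in> I\<close> adjs] by blast
    qed
  qed simp
  moreover have "gate k x = x" "gate k y = y" if "\<not> descends k x"
    using gate_eqI[of k x x] gate_eqI[of k y y] follows_in[OF assms(1)] follows_dist[OF assms(1)] that assms(2)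
    by simp_all
  ultimately show ?thesis using assms by metis
qed

lemma follows_unique:
  assumes "follows col col' x y" "follows col col' x y'"
  shows "y = y'"
  using assms
proof (induction "len (\<delta> x c)" arbitrary: x y y' rule: less_induct)
  case less
  have in_Ch: "x \<in> Ch" "y \<in> Ch" "y' \<in> Ch" using less.prems follows_in by blast+
  show ?case
  proof (cases "x = c")
    case True
    then show ?thesis using follows_dist[OF less.prems(1)] follows_dist[OF less.prems(2)] in_Ch
      by (metis at_root)
  next
    case False
    then obtain k where k: "k \<in> I" "descends k x" using ex_descends in_Ch by blast
    have "gate k y = gate k y'"
      using less.hyps[OF dist_gate(2)[OF k(1) in_Ch(1) k(2)]] follows_gate less.prems k by blast
    then have "adj k y y'" using adj_gate[of k y] adj_gate[of k y'] adj_sym adj_trans k in_Ch by metis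
    moreover have "col' k y = col' k y'" using follows_col less.prems k by metis
    ultimately show ?thesis using colouring_inj[OF col'] k by blast
  qed
qed

lemma follows_adj:
  assumes "k \<in> I" "adj k x x'" "follows col col' x y" "follows col col' x' y'"
  shows "adj k y y'"
proof -
  have in_Ch: "y \<in> Ch" "y' \<in> Ch" using assms follows_in by blast+
  have "gate k y = gate k y'"
    using follows_gate assms gate_adj follows_unique by metis
  then show ?thesis using adj_gate[of k y] adj_gate[of k y'] adj_sym adj_trans assms(1) in_Ch by metis
qed

text \<open>
  Minimal galleries from the root to a chamber of \<open>S\<close> stay inside \<open>S\<close>, where the colours of their
  steps agree.
\<close>

lemma follows_fixed:
  assumes "x \<in> S" "S \<subseteq> Ch"
    and S: "\<And>x k. x \<in> S \<Longrightarrow> k \<in> I \<Longrightarrow> descends k x \<Longrightarrow> gate k x \<in> S \<and> col k x = col' k x"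
  shows "follows col col' x x"
  using assms(1)
proof (induction "len (\<delta> x c)" arbitrary: x rule: less_induct)
  case less
  then have x: "x \<in> Ch" using assms by blast
  show ?case
  proof (cases "x = c")
    case True
    then show ?thesis using follows.base by simp
  next
    case False
    then obtain k where k: "k \<in> I" "descends k x" using ex_descends x by blast
    have IH: "follows col col' (gate k x) (gate k x)"
      using less dist_gate(2) x k S by blast
    have a: "adj k (gate k x) x" using adj_gate adj_sym k x by blast
    have "\<not> descends k (gate k x)" using not_descends_gate k x by blast
    then show ?thesis using follows_up[OF IH k(1) a a] S[OF less.prems k] k by metis
  qed
qed

end

lemma colouring_transport:
  assumes col: "colouring col" and col': "colouring col'"
  obtains h where "h \<in> type_pres_auts Ch \<delta>" "\<And>x. x \<in> Ch \<Longrightarrow> follows col col' x (h x)"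
proof -
  define h where "h = (\<lambda>x\<in>Ch. THE y. follows col col' x y)"
  have h: "follows col col' x (h x)" if "x \<in> Ch" for x
    unfolding h_def using that follows_total[OF col col' that] follows_unique[OF col col']
    by (auto intro: theI2)
  have into: "h \<in> Ch \<rightarrow> Ch" using h follows_in by blast
  have inj: "inj_on h Ch"
  proof (rule inj_onI)
    fix x y assume "x \<in> Ch" "y \<in> Ch" "h x = h y"
    then have "follows col' col (h x) x" "follows col' col (h x) y"
      using h follows_sym by metis+
    then show "x = y" using follows_unique[OF col' col] by blast
  qed
  have surj: "h ` Ch = Ch"
  proof (intro equalityI subsetI)
    fix y assume y: "y \<in> Ch"
    then obtain x where x: "follows col' col y x" using follows_total[OF col' col] by blast
    then have "x \<in> Ch" using follows_in by blast
    then have "h x = y" using h follows_unique[OF col col'] follows_sym x by blast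
    then show "y \<in> h ` Ch" using \<open>x \<in> Ch\<close> by blast
  qed (use into in auto)
  have "adj k (h x) (h y)" if "k \<in> I" "adj k x y" for k x y
    using follows_adj[OF col col' that] h that adj_in by blast
  then have "\<delta> (h x) (h y) = \<delta> x y" if "x \<in> Ch" "y \<in> Ch" for x y
    using dist_preserving[OF into inj] that by blast
  moreover have "h \<in> Bij Ch" using inj surj by (auto simp: Bij_def bij_betw_def h_def)
  ultimately have "h \<in> type_pres_auts Ch \<delta>" by (simp add: type_pres_auts_def)
  then show ?thesis using that h by blast
qed

text \<open>
  In a right-angled Coxeter group the centraliser of \<open>r j\<close> is generated by \<open>j\<close> and the generators
  commuting with it, so the condition on \<open>\<delta> x c\<close> singles out the residue of type \<open>j \<union> j\<^sup>\<bottom>\<close> of the root.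
\<close>

definition swap_colours :: "'i \<Rightarrow> 'c \<Rightarrow> 'c \<Rightarrow> ('i \<Rightarrow> 'c \<Rightarrow> 'c) \<Rightarrow> 'i \<Rightarrow> 'c \<Rightarrow> 'c" where
  "swap_colours j a b col k x =
    (if k = j \<and> r j \<otimes> \<delta> x c = \<delta> x c \<otimes> r j then Transposition.transpose a b (col k x) else col k x)"

lemma swap_colours_eq:
  assumes "\<not> (k = j \<and> r j \<otimes> \<delta> x c = \<delta> x c \<otimes> r j)"
  shows "swap_colours j a b col k x = col k x"
  using assms unfolding swap_colours_def by presburger

lemma central_adj:
  assumes "j \<in> I" "l \<in> I" "r j \<otimes> r l = r l \<otimes> r j" "adj l x y"
  shows "r j \<otimes> \<delta> x c = \<delta> x c \<otimes> r j \<longleftrightarrow> r j \<otimes> \<delta> y c = \<delta> y c \<otimes> r j"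
proof -
  have "r j \<otimes> (r l \<otimes> w) = r l \<otimes> w \<otimes> r j \<longleftrightarrow> r j \<otimes> w = w \<otimes> r j" if w: "w \<in> carrier W" for w
  proof -
    have "r j \<otimes> (r l \<otimes> w) = (r j \<otimes> r l) \<otimes> w" using assms(1,2) w by (simp add: m_assoc)
    also have "\<dots> = r l \<otimes> (r j \<otimes> w)" unfolding assms(3) using assms(1,2) w by (simp add: m_assoc)
    finally have "r j \<otimes> (r l \<otimes> w) = r l \<otimes> (r j \<otimes> w)" .
    moreover have "r l \<otimes> w \<otimes> r j = r l \<otimes> (w \<otimes> r j)" using assms(1,2) w by (simp add: m_assoc)
    moreover have "r l \<otimes> (r j \<otimes> w) = r l \<otimes> (w \<otimes> r j) \<longleftrightarrow> r j \<otimes> w = w \<otimes> r j"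
      using assms(1,2) w by simp
    ultimately show ?thesis by metis
  qed
  then show ?thesis using adj_step[OF assms(2,4) root_in] adj_in[OF assms(4)] by auto
qed

lemma colouring_swap:
  assumes col: "colouring col" and j: "j \<in> I" and a: "adj j c a" "a \<noteq> c" and b: "adj j c b" "b \<noteq> c"
  shows "colouring (swap_colours j a b col)"
  unfolding colouring_def
proof (intro conjI ballI allI impI)
  fix k x assume k: "k \<in> I" and x: "x \<in> Ch"
  let ?P = "\<lambda>x. k = j \<and> r j \<otimes> \<delta> x c = \<delta> x c \<otimes> r j"
  have P: "?P y \<longleftrightarrow> ?P x" if "adj k x y" for y
    using central_adj[OF j j _] that by blast
  show "bij_betw (swap_colours j a b col k) {y. adj k x y} {y. adj k c y}"
  proof (cases "?P x")
    case True
    have "bij_betw (Transposition.transpose a b) {y. adj j c y} {y. adj j c y}"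
      using a b by (auto simp: bij_betw_def inj_on_def image_iff Transposition.transpose_def split: if_splits)
    then have "bij_betw (Transposition.transpose a b \<circ> col k) {y. adj k x y} {y. adj k c y}"
      using colouring_bij[OF col k x] True by (metis bij_betw_trans)
    moreover have "(Transposition.transpose a b \<circ> col k) y = swap_colours j a b col k y" if "y \<in> {y. adj k x y}" for y
      using True P[of y] that by (simp add: swap_colours_def)
    ultimately show ?thesis using bij_betw_cong[of "{y. adj k x y}"] by blast
  next
    case False
    have "col k y = swap_colours j a b col k y" if "y \<in> {y. adj k x y}" for y
    proof -
      have "\<not> ?P y" using False P that by blast
      then show ?thesis using swap_colours_eq by metis
    qed
    then show ?thesis using bij_betw_cong[of "{y. adj k x y}"] colouring_bij[OF col k x] by blast
  qed
next
  fix k l x y assume *: "k \<in> I" "l \<in> I" "m k l = 2" "adj l x y"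
  have "col k x = col k y" using colouring_perp[OF col *] .
  then show "swap_colours j a b col k x = swap_colours j a b col k y"
    using central_adj[of k l x y] gen_commute * by (auto simp: swap_colours_def)
next
  fix k x assume "k \<in> I" "x \<in> Ch"
  then show "swap_colours j a b col k x = c \<longleftrightarrow> \<not> descends k x"
    using colouring_descends[OF col, of k x] a b by (auto simp: swap_colours_def Transposition.transpose_def)
qed

text \<open>
  The automorphism taking a colouring to the one with two colours exchanged.  Outside the wings
  no colour is changed: a chamber with an exchanged colour has \<open>j\<close> as a left descent of a
  distance commuting with \<open>r j\<close>, and hence also as a right descent.
\<close>

lemma ex_wing_automorphism:
  assumes sr: "semi_regular_building W I r Ch \<delta>" and thick: "thick_building W I r Ch \<delta>"
    and j: "j \<in> I"
  shows "\<exists>g\<in>type_pres_auts Ch \<delta>. (\<forall>x\<in>Ch. \<not> rdesc j (\<delta> x c) \<longrightarrow> g x = x) \<and> (\<exists>x\<in>Ch. g x \<noteq> x)"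
proof -
  obtain col where col: "colouring col" using ex_colouring sr by blast
  have "\<exists>a b. a \<in> {y. adj j c y} - {c} \<and> b \<in> {y. adj j c y} - {c} \<and> a \<noteq> b"
  proof -
    let ?P = "{y. adj j c y} - {c}"
    have "infinite {y. adj j c y} \<or> card {y. adj j c y} > 2"
      using thick j by (simp add: thick_building_def flip: panel_eq)
    then have "infinite ?P \<or> card ?P > 1" by (auto simp: card_Diff_singleton)
    then have "\<not> (\<exists>a. ?P \<subseteq> {a})" by (metis card_mono card.empty card_insert_disjoint empty_iff finite.emptyI finite.insertI finite_subset leD One_nat_def)
    then show ?thesis by blast
  qed
  then obtain a b where a: "adj j c a" "a \<noteq> c" and b: "adj j c b" "b \<noteq> c" and ab: "a \<noteq> b"
    by blast
  let ?col = "swap_colours j a b col"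
  have col': "colouring ?col" using colouring_swap[OF col j a b] .
  obtain h where h: "h \<in> type_pres_auts Ch \<delta>" "\<And>x. x \<in> Ch \<Longrightarrow> follows col ?col x (h x)"
    using colouring_transport[OF col col'] by blast
  have "h x = x" if "x \<in> Ch" "\<not> rdesc j (\<delta> x c)" for x
  proof -
    have "follows col ?col x x"
    proof (rule follows_fixed[OF col col', of x "{x \<in> Ch. \<not> rdesc j (\<delta> x c)}"])
      fix x k assume x: "x \<in> {x \<in> Ch. \<not> rdesc j (\<delta> x c)}" and k: "k \<in> I" "descends k x"
      have "\<not> rdesc j (\<delta> (gate k x) c)"
        using rdesc_up[of j k "\<delta> (gate k x) c"] dist_gate(1)[of k x] not_descends_gate[of k x] j k x by auto
      moreover have "\<not> (k = j \<and> r j \<otimes> \<delta> x c = \<delta> x c \<otimes> r j)"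
        using rdesc_central[OF j, of "\<delta> x c"] x k by auto
      ultimately show "gate k x \<in> {x \<in> Ch. \<not> rdesc j (\<delta> x c)} \<and> col k x = ?col k x"
        using x k swap_colours_eq[of k j x] by simp
    qed (use that in auto)
    then show ?thesis using h(2) follows_unique[OF col col'] that by blast
  qed
  moreover obtain d where d: "adj j c d" "col j d = a"
    using colouring_ex[OF col j root_in a(1)] by blast
  have "h d \<noteq> d"
  proof
    assume "h d = d"
    then have "?col j d = a" using follows_col[OF col col' h(2) j] d adj_in by metis
    moreover have "d \<noteq> c" using colouring_descends[OF col j root_in] d a by auto
    then have "\<delta> d c = r j" using adj_dist adj_sym j d by blast
    then have "?col j d = b" using d by (simp add: swap_colours_def)
    ultimately show False using ab by simp
  qed
  ultimately show ?thesis using h(1) d adj_in by blast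
qed

end

section \<open>Products of two commuting subgroups\<close>

lemma (in group) generate_subgroup_self: "subgroup H G \<Longrightarrow> generate G H = H"
  by (rule generateI[symmetric]) auto

context group begin

lemma set_mult_memI: "a \<in> A \<Longrightarrow> b \<in> B \<Longrightarrow> a \<otimes> b \<in> A <#> B"
  by (auto simp: set_mult_def)

context
  fixes A B :: "'a set"
  assumes A: "subgroup A G" and B: "subgroup B G"
    and comm: "\<And>a b. a \<in> A \<Longrightarrow> b \<in> B \<Longrightarrow> a \<otimes> b = b \<otimes> a"
begin

lemma in_AB: "a \<in> A \<Longrightarrow> a \<in> carrier G" "b \<in> B \<Longrightarrow> b \<in> carrier G"
  by (rule subgroup.mem_carrier[OF A], assumption) (rule subgroup.mem_carrier[OF B])

lemma subgroup_commuting_product: "subgroup (A <#> B) G"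
proof (rule subgroupI)
  show "A <#> B \<subseteq> carrier G" using in_AB by (auto simp: set_mult_def)
  have "\<one> \<otimes> \<one> \<in> A <#> B"
    by (intro set_mult_memI subgroup.one_closed A B)
  then show "A <#> B \<noteq> {}" by blast
next
  fix x assume "x \<in> A <#> B"
  then obtain a b where x: "a \<in> A" "b \<in> B" "x = a \<otimes> b" by (auto simp: set_mult_def)
  then have i: "inv a \<in> A" "inv b \<in> B" using A B by (auto simp: subgroup.m_inv_closed)
  have "inv x = inv b \<otimes> inv a" using x in_AB by (simp add: inv_mult_group)
  also have "\<dots> = inv a \<otimes> inv b" using comm[OF i] by simp
  finally show "inv x \<in> A <#> B" using set_mult_memI[OF i] by simp
next
  fix x y assume "x \<in> A <#> B" "y \<in> A <#> B"
  then obtain a b a' b' where x: "a \<in> A" "b \<in> B" "x = a \<otimes> b" and y: "a' \<in> A" "b' \<in> B" "y = a' \<otimes> b'"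
    by (auto simp: set_mult_def)
  have "x \<otimes> y = a \<otimes> (b \<otimes> a') \<otimes> b'" using x y in_AB by (simp add: m_assoc)
  also have "\<dots> = a \<otimes> (a' \<otimes> b) \<otimes> b'" using comm[of a' b] x y by simp
  also have "\<dots> = (a \<otimes> a') \<otimes> (b \<otimes> b')" using x y in_AB by (simp add: m_assoc)
  finally show "x \<otimes> y \<in> A <#> B"
    using set_mult_memI[OF subgroup.m_closed[OF A x(1) y(1)] subgroup.m_closed[OF B x(2) y(2)]] by simp
qed

lemma subset_commuting_product: "A \<subseteq> A <#> B" "B \<subseteq> A <#> B"
proof -
  have "a \<otimes> \<one> \<in> A <#> B" if "a \<in> A" for a
    by (rule set_mult_memI[OF that subgroup.one_closed[OF B]])
  then show "A \<subseteq> A <#> B" using in_AB(1) by auto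
  have "\<one> \<otimes> b \<in> A <#> B" if "b \<in> B" for b
    by (rule set_mult_memI[OF subgroup.one_closed[OF A] that])
  then show "B \<subseteq> A <#> B" using in_AB(2) by auto
qed

lemma generate_commuting_product: "generate G (A \<union> B) = A <#> B"
proof (rule generateI[symmetric])
  show "subgroup (A <#> B) G" by (rule subgroup_commuting_product)
  show "A \<union> B \<subseteq> A <#> B" using subset_commuting_product by blast
  fix K assume "subgroup K G" "A \<union> B \<subseteq> K"
  then show "A <#> B \<subseteq> K" by (auto simp: set_mult_def intro!: subgroup.m_closed[of K])
qed

lemma conj_commuting_product:
  assumes "x = a \<otimes> b" "a \<in> A" "b \<in> B" "h \<in> A"
  shows "x \<otimes> h \<otimes> inv x = a \<otimes> h \<otimes> inv a"
proof -
  have "x \<otimes> h \<otimes> inv x = a \<otimes> (b \<otimes> h) \<otimes> inv b \<otimes> inv a"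
    using assms in_AB by (simp add: m_assoc inv_mult_group)
  also have "\<dots> = a \<otimes> (h \<otimes> b) \<otimes> inv b \<otimes> inv a" using comm assms by simp
  also have "\<dots> = a \<otimes> h \<otimes> inv a" using assms in_AB by (simp add: m_assoc)
  finally show ?thesis .
qed

lemma normal_in_commuting_product: "A \<lhd> G\<lparr>carrier := A <#> B\<rparr>"
proof -
  interpret P: group "G\<lparr>carrier := A <#> B\<rparr>"
    using subgroup.subgroup_is_group subgroup_commuting_product is_group by blast
  show ?thesis
    unfolding P.normal_inv_iff
  proof (intro conjI ballI)
    show "subgroup A (G\<lparr>carrier := A <#> B\<rparr>)"
      using subgroup_incl A subgroup_commuting_product subset_commuting_product by blast
    fix x h assume "x \<in> carrier (G\<lparr>carrier := A <#> B\<rparr>)" "h \<in> A"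
    then obtain a b where x: "x \<in> A <#> B" "x = a \<otimes> b" "a \<in> A" "b \<in> B" by (auto simp: set_mult_def)
    have "a \<otimes> h \<otimes> inv a \<in> A"
      using x(3) \<open>h \<in> A\<close> A by (simp add: subgroup.m_closed subgroup.m_inv_closed)
    then show "x \<otimes>\<^bsub>G\<lparr>carrier := A <#> B\<rparr>\<^esub> h \<otimes>\<^bsub>G\<lparr>carrier := A <#> B\<rparr>\<^esub>
        inv\<^bsub>G\<lparr>carrier := A <#> B\<rparr>\<^esub> x \<in> A"
      using conj_commuting_product[OF x(2-4) \<open>h \<in> A\<close>] m_inv_consistent[OF subgroup_commuting_product x(1)]
      by simp
  qed
qed

end

lemma direct_decomposition_commuting_product:
  assumes A: "subgroup A G" and B: "subgroup B G"
    and comm: "\<And>a b. a \<in> A \<Longrightarrow> b \<in> B \<Longrightarrow> a \<otimes> b = b \<otimes> a"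
    and int: "A \<inter> B = {\<one>}" and nontriv: "A \<noteq> {\<one>}" "B \<noteq> {\<one>}"
  shows "nontrivial_direct_decomposition G (A <#> B) {0, 1 :: nat} (\<lambda>j. if j = 0 then A else B)"
proof -
  have BA: "B <#> A = A <#> B" using comm by (force simp: set_mult_def)
  have "B \<lhd> G\<lparr>carrier := A <#> B\<rparr>"
    using normal_in_commuting_product[OF B A] comm BA by metis
  moreover have "(\<Union>k\<in>{0, 1 :: nat} - {0}. if k = 0 then A else B) = B"
    "(\<Union>k\<in>{0, 1 :: nat} - {1}. if k = 0 then A else B) = A"
    "(\<Union>k\<in>{0, 1 :: nat}. if k = 0 then A else B) = A \<union> B"
    by auto
  ultimately show ?thesis
    using normal_in_commuting_product[OF A B comm] subgroup_commuting_product[OF A B comm]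
      generate_commuting_product[OF A B comm] generate_subgroup_self[OF A] generate_subgroup_self[OF B]
      int nontriv
    unfolding nontrivial_direct_decomposition_def internal_direct_product_def
    by (simp add: Int_commute)
qed

lemma normalizer_memI:
  assumes H: "H \<subseteq> carrier G" and g: "g \<in> carrier G"
    and conj: "\<And>h. h \<in> H \<Longrightarrow> g \<otimes> h \<otimes> inv g \<in> H" "\<And>h. h \<in> H \<Longrightarrow> inv g \<otimes> h \<otimes> g \<in> H"
  shows "g \<in> normalizer G H"
proof -
  have "g <# H #> inv g = H"
  proof (intro equalityI subsetI)
    fix x assume "x \<in> g <# H #> inv g"
    then show "x \<in> H" using conj(1) by (auto simp: l_coset_def r_coset_def)
  next
    fix x assume x: "x \<in> H"
    then have "x \<in> carrier G" using H by blast
    then have "g \<otimes> (inv g \<otimes> x \<otimes> g) \<otimes> inv g = (g \<otimes> inv g) \<otimes> x \<otimes> (g \<otimes> inv g)"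
      using g by (simp only: m_assoc m_closed inv_closed)
    then have "g \<otimes> (inv g \<otimes> x \<otimes> g) \<otimes> inv g = x" using g \<open>x \<in> carrier G\<close> by simp
    then have "x = g \<otimes> (inv g \<otimes> x \<otimes> g) \<otimes> inv g" by simp
    then show "x \<in> g <# H #> inv g" using conj(2)[OF x] by (auto simp: l_coset_def r_coset_def)
  qed
  then show ?thesis using H g by (simp add: normalizer_def stabilizer_def)
qed

end

section \<open>The automorphism group and its topology\<close>

context right_angled_building begin

abbreviation "Aut \<equiv> AutPlus Ch \<delta>"
abbreviation "AutT \<equiv> AutPlus_topology Ch \<delta>"

lemma carrier_Aut [simp]: "carrier Aut = type_pres_auts Ch \<delta>"
  by (simp add: AutPlus_def)

lemma aut_dist: "g \<in> type_pres_auts Ch \<delta> \<Longrightarrow> x \<in> Ch \<Longrightarrow> y \<in> Ch \<Longrightarrow> \<delta> (g x) (g y) = \<delta> x y"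
  by (auto simp: type_pres_auts_def)

lemma aut_Bij: "g \<in> type_pres_auts Ch \<delta> \<Longrightarrow> g \<in> Bij Ch"
  by (auto simp: type_pres_auts_def)

lemma aut_in [simp]: "g \<in> type_pres_auts Ch \<delta> \<Longrightarrow> x \<in> Ch \<Longrightarrow> g x \<in> Ch"
  using aut_Bij Bij_imp_funcset by fastforce

lemma aut_eqI: "g \<in> type_pres_auts Ch \<delta> \<Longrightarrow> h \<in> type_pres_auts Ch \<delta> \<Longrightarrow>
    (\<And>x. x \<in> Ch \<Longrightarrow> g x = h x) \<Longrightarrow> g = h"
  using aut_Bij Bij_imp_extensional extensionalityI by metis

lemma mult_Aut: "g \<in> type_pres_auts Ch \<delta> \<Longrightarrow> h \<in> type_pres_auts Ch \<delta> \<Longrightarrow>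
    g \<otimes>\<^bsub>Aut\<^esub> h = compose Ch g h"
  using aut_Bij by (simp add: AutPlus_def BijGroup_def)

lemma one_Aut: "\<one>\<^bsub>Aut\<^esub> = (\<lambda>x\<in>Ch. x)"
  by (simp add: AutPlus_def BijGroup_def)

lemma subgroup_auts: "subgroup (type_pres_auts Ch \<delta>) (BijGroup Ch)"
proof (rule group.subgroupI[OF group_BijGroup])
  show "type_pres_auts Ch \<delta> \<subseteq> carrier (BijGroup Ch)" using aut_Bij by (auto simp: BijGroup_def)
  have "(\<lambda>x\<in>Ch. x) \<in> type_pres_auts Ch \<delta>" by (auto simp: type_pres_auts_def id_Bij)
  then show "type_pres_auts Ch \<delta> \<noteq> {}" by blast
next
  fix g assume g: "g \<in> type_pres_auts Ch \<delta>"
  have g': "bij_betw g Ch Ch" using aut_Bij[OF g] by (simp add: Bij_def)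
  have "\<delta> (inv_into Ch g x) (inv_into Ch g y) = \<delta> x y" if "x \<in> Ch" "y \<in> Ch" for x y
    using aut_dist[OF g, of "inv_into Ch g x" "inv_into Ch g y"] g' that
    by (metis bij_betw_def bij_betw_inv_into_right inv_into_into)
  then show "inv\<^bsub>BijGroup Ch\<^esub> g \<in> type_pres_auts Ch \<delta>"
    using restrict_inv_into_Bij[OF aut_Bij[OF g]]
    by (simp add: inv_BijGroup aut_Bij[OF g] type_pres_auts_def)
next
  fix g h assume g: "g \<in> type_pres_auts Ch \<delta>" and h: "h \<in> type_pres_auts Ch \<delta>"
  have eq: "g \<otimes>\<^bsub>BijGroup Ch\<^esub> h = compose Ch g h"
    using aut_Bij[OF g] aut_Bij[OF h] by (simp add: BijGroup_def)
  have "\<delta> (compose Ch g h x) (compose Ch g h y) = \<delta> x y" if "x \<in> Ch" "y \<in> Ch" for x y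
    using aut_dist[OF g aut_in[OF h that(1)] aut_in[OF h that(2)]] aut_dist[OF h that] that
    by (simp add: compose_eq)
  then show "g \<otimes>\<^bsub>BijGroup Ch\<^esub> h \<in> type_pres_auts Ch \<delta>"
    unfolding eq type_pres_auts_def using compose_Bij[OF aut_Bij[OF g] aut_Bij[OF h]] by blast
qed

lemma group_Aut: "group Aut"
  unfolding AutPlus_def by (rule subgroup.subgroup_is_group[OF subgroup_auts group_BijGroup])

sublocale Aut: group Aut by (rule group_Aut)

lemma mult_apply [simp]: "g \<in> type_pres_auts Ch \<delta> \<Longrightarrow> h \<in> type_pres_auts Ch \<delta> \<Longrightarrow> x \<in> Ch \<Longrightarrow>
    (g \<otimes>\<^bsub>Aut\<^esub> h) x = g (h x)"
  by (simp add: mult_Aut compose_def)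

lemma one_apply [simp]: "x \<in> Ch \<Longrightarrow> \<one>\<^bsub>Aut\<^esub> x = x"
  by (simp add: one_Aut)

lemma mult_aut [simp]: "g \<in> type_pres_auts Ch \<delta> \<Longrightarrow> h \<in> type_pres_auts Ch \<delta> \<Longrightarrow>
    g \<otimes>\<^bsub>Aut\<^esub> h \<in> type_pres_auts Ch \<delta>"
  using Aut.m_closed by simp

lemma inv_aut [simp]: "g \<in> type_pres_auts Ch \<delta> \<Longrightarrow> inv\<^bsub>Aut\<^esub> g \<in> type_pres_auts Ch \<delta>"
  using Aut.inv_closed by simp

lemma inv_apply [simp]: "g \<in> type_pres_auts Ch \<delta> \<Longrightarrow> x \<in> Ch \<Longrightarrow> (inv\<^bsub>Aut\<^esub> g) (g x) = x"
  using mult_apply[of "inv\<^bsub>Aut\<^esub> g" g x] Aut.l_inv[of g] by simp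

lemma apply_inv [simp]: "g \<in> type_pres_auts Ch \<delta> \<Longrightarrow> x \<in> Ch \<Longrightarrow> g ((inv\<^bsub>Aut\<^esub> g) x) = x"
  using mult_apply[of g "inv\<^bsub>Aut\<^esub> g" x] Aut.r_inv[of g] by simp

definition fixator :: "'c set \<Rightarrow> ('c \<Rightarrow> 'c) set" where
  "fixator F = {g \<in> type_pres_auts Ch \<delta>. \<forall>x\<in>F. g x = x}"

lemma fixator_aut: "g \<in> fixator F \<Longrightarrow> g \<in> type_pres_auts Ch \<delta>"
  and fixator_fix: "g \<in> fixator F \<Longrightarrow> x \<in> F \<Longrightarrow> g x = x"
  by (auto simp: fixator_def)

lemma subgroup_fixator:
  assumes "F \<subseteq> Ch"
  shows "subgroup (fixator F) Aut"
proof (rule Aut.subgroupI)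
  have "\<one>\<^bsub>Aut\<^esub> \<in> fixator F"
    using assms Aut.one_closed by (auto simp: fixator_def)
  then show "fixator F \<noteq> {}" by blast
next
  fix g assume g: "g \<in> fixator F"
  then have "(inv\<^bsub>Aut\<^esub> g) x = x" if "x \<in> F" for x
    using inv_apply[of g x] that assms unfolding fixator_def by auto
  then show "inv\<^bsub>Aut\<^esub> g \<in> fixator F" using g by (simp add: fixator_def)
next
  fix g h assume *: "g \<in> fixator F" "h \<in> fixator F"
  then have "(g \<otimes>\<^bsub>Aut\<^esub> h) x = x" if "x \<in> F" for x
    using mult_apply[of g h x] that assms unfolding fixator_def by auto
  then show "g \<otimes>\<^bsub>Aut\<^esub> h \<in> fixator F" using * by (simp add: fixator_def)
qed (auto simp: fixator_def)

lemma fixator_conj: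
  assumes "F \<subseteq> Ch" "g \<in> type_pres_auts Ch \<delta>" "h \<in> fixator F" "\<And>x. x \<in> F \<Longrightarrow> (inv\<^bsub>Aut\<^esub> g) x \<in> F"
  shows "g \<otimes>\<^bsub>Aut\<^esub> h \<otimes>\<^bsub>Aut\<^esub> inv\<^bsub>Aut\<^esub> g \<in> fixator F"
  using assms by (auto simp: fixator_def)

lemma fixator_moves:
  assumes "F \<subseteq> Ch" "g \<in> fixator F" "x \<in> Ch - F"
  shows "g x \<in> Ch - F"
proof -
  have g: "g \<in> type_pres_auts Ch \<delta>" using assms by (simp add: fixator_def)
  have "g x \<notin> F"
  proof
    assume "g x \<in> F"
    then have "g (g x) = g x" using assms by (simp add: fixator_def)
    then have "g x = x" using inv_apply[OF g] assms(3) g by (metis DiffD1 aut_in)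
    then show False using \<open>g x \<in> F\<close> assms by simp
  qed
  then show ?thesis using g assms by simp
qed

lemma fixators_commute:
  assumes F: "F \<subseteq> Ch" "F' \<subseteq> Ch" "F \<union> F' = Ch" and g: "g \<in> fixator F" and h: "h \<in> fixator F'"
  shows "g \<otimes>\<^bsub>Aut\<^esub> h = h \<otimes>\<^bsub>Aut\<^esub> g"
proof -
  have gh: "g \<in> type_pres_auts Ch \<delta>" "h \<in> type_pres_auts Ch \<delta>" using g h fixator_aut by auto
  have "g (h x) = h (g x)" if x: "x \<in> Ch" for x
  proof (cases "x \<in> F")
    case True
    show ?thesis
    proof (cases "x \<in> F'")
      case False
      then have "h x \<in> F" using fixator_moves[OF F(2) h] x F(3) by blast
      then show ?thesis using fixator_fix[OF g] True by simp
    qed (use True g h fixator_fix in metis)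
  next
    case False
    then have "g x \<in> F'" "x \<in> F'" using fixator_moves[OF F(1) g] x F(3) by blast+
    then show ?thesis using fixator_fix[OF h] by simp
  qed
  then show ?thesis using gh by (intro aut_eqI) simp_all
qed

lemma fixators_Int:
  assumes F: "F \<subseteq> Ch" "F' \<subseteq> Ch" "F \<union> F' = Ch"
  shows "fixator F \<inter> fixator F' = {\<one>\<^bsub>Aut\<^esub>}"
proof -
  have "g = \<one>\<^bsub>Aut\<^esub>" if g: "g \<in> fixator F" "g \<in> fixator F'" for g
  proof (rule aut_eqI)
    show "\<one>\<^bsub>Aut\<^esub> \<in> type_pres_auts Ch \<delta>" using Aut.one_closed by simp
    fix x assume x: "x \<in> Ch"
    then have "g x = x" using F(3) fixator_fix[OF g(1)] fixator_fix[OF g(2)] by blast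
    then show "g x = \<one>\<^bsub>Aut\<^esub> x" using x by simp
  qed (rule fixator_aut[OF g(1)])
  moreover have "\<one>\<^bsub>Aut\<^esub> \<in> fixator F \<inter> fixator F'"
    by (intro IntI subgroup.one_closed subgroup_fixator F)
  ultimately show ?thesis by (intro equalityI subsetI) (elim IntE, metis singletonI, metis singletonD)
qed

text \<open>
  As the supports are disjoint, the product of \<open>g\<close> and \<open>h\<close> is pointwise one of the two factors.  This
  makes the multiplication of the two fixators visibly continuous in the pair \<open>(g, h)\<close>.
\<close>

lemma fixators_mult_apply:
  assumes F: "F \<subseteq> Ch" "F' \<subseteq> Ch" "F \<union> F' = Ch" and g: "g \<in> fixator F" and h: "h \<in> fixator F'"
    and x: "x \<in> Ch"
  shows "(g \<otimes>\<^bsub>Aut\<^esub> h) x = (if x \<in> F' then g x else h x)"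
proof -
  have gh: "g \<in> type_pres_auts Ch \<delta>" "h \<in> type_pres_auts Ch \<delta>" using g h fixator_aut by auto
  have "h x \<in> F" if "x \<notin> F'" using fixator_moves[OF F(2) h] x that F(3) by blast
  then show ?thesis using gh x fixator_fix[OF g] fixator_fix[OF h] by simp
qed

abbreviation "ProdT \<equiv> product_topology (\<lambda>_. discrete_topology Ch) Ch"

lemma auts_subset_PiE: "type_pres_auts Ch \<delta> \<subseteq> Ch \<rightarrow>\<^sub>E Ch"
  using aut_Bij Bij_imp_extensional Bij_imp_funcset by (auto simp: PiE_iff extensional_def)

lemma topspace_Aut [simp]: "topspace AutT = type_pres_auts Ch \<delta>"
  using auts_subset_PiE by (auto simp: AutPlus_topology_def)

lemma continuous_eval: "x \<in> Ch \<Longrightarrow> continuous_map ProdT (discrete_topology Ch) (\<lambda>g. g x)"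
  by (rule continuous_map_product_projection)

lemma openin_agree:
  assumes "x \<in> Ch"
  shows "openin AutT {h \<in> type_pres_auts Ch \<delta>. h x = y}"
proof -
  have "continuous_map AutT (discrete_topology Ch) (\<lambda>g. g x)"
    unfolding AutPlus_topology_def using continuous_eval[OF assms] by (rule continuous_map_from_subtopology)
  then have "openin AutT {h \<in> topspace AutT. h x \<in> {y} \<inter> Ch}"
    by (rule openin_continuous_map_preimage) simp
  moreover have "{h \<in> topspace AutT. h x \<in> {y} \<inter> Ch} = {h \<in> type_pres_auts Ch \<delta>. h x = y}"
    using assms by auto
  ultimately show ?thesis by simp
qed

text \<open>
  A subgroup containing the stabiliser of a chamber is a union of cosets of that stabiliser, each of
  which is the set of automorphisms with a prescribed value at \<open>c\<close>.
\<close>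

lemma openin_normalizer:
  assumes c: "c \<in> Ch" and H: "H \<subseteq> type_pres_auts Ch \<delta>"
    and conj: "\<And>g h. g \<in> type_pres_auts Ch \<delta> \<Longrightarrow> g c = c \<Longrightarrow> h \<in> H \<Longrightarrow>
      g \<otimes>\<^bsub>Aut\<^esub> h \<otimes>\<^bsub>Aut\<^esub> inv\<^bsub>Aut\<^esub> g \<in> H"
  shows "openin AutT (normalizer Aut H)"
proof -
  have N: "subgroup (normalizer Aut H) Aut" using Aut.normalizer_imp_subgroup H by simp
  have stab: "g \<in> normalizer Aut H" if g: "g \<in> type_pres_auts Ch \<delta>" "g c = c" for g
  proof (rule Aut.normalizer_memI)
    have "(inv\<^bsub>Aut\<^esub> g) c = c" using inv_apply[OF g(1) c] g(2) by simp
    then show "inv\<^bsub>Aut\<^esub> g \<otimes>\<^bsub>Aut\<^esub> h \<otimes>\<^bsub>Aut\<^esub> g \<in> H" if "h \<in> H" for h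
      using conj[of "inv\<^bsub>Aut\<^esub> g" h] that g by simp
  qed (use conj g H in auto)
  show ?thesis
    unfolding openin_subopen[of _ "normalizer Aut H"]
  proof (intro ballI)
    fix g assume g: "g \<in> normalizer Aut H"
    then have g': "g \<in> type_pres_auts Ch \<delta>" using subgroup.mem_carrier[OF N] by simp
    have "h \<in> normalizer Aut H" if h: "h \<in> type_pres_auts Ch \<delta>" "h c = g c" for h
    proof -
      have "inv\<^bsub>Aut\<^esub> g \<otimes>\<^bsub>Aut\<^esub> h \<in> normalizer Aut H" using stab h g' c by simp
      then have "g \<otimes>\<^bsub>Aut\<^esub> (inv\<^bsub>Aut\<^esub> g \<otimes>\<^bsub>Aut\<^esub> h) \<in> normalizer Aut H"
        using subgroup.m_closed[OF N g] by blast
      moreover have "g \<otimes>\<^bsub>Aut\<^esub> (inv\<^bsub>Aut\<^esub> g \<otimes>\<^bsub>Aut\<^esub> h) = h"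
        using g' h by (simp flip: Aut.m_assoc)
      ultimately show ?thesis by simp
    qed
    then show "\<exists>T. openin AutT T \<and> g \<in> T \<and> T \<subseteq> normalizer Aut H"
      using openin_agree[OF c, of "g c"] g' by (intro exI[of _ "{h \<in> type_pres_auts Ch \<delta>. h c = g c}"]) auto
  qed
qed

lemma closedin_dist_preserving:
  assumes "x \<in> Ch" "y \<in> Ch"
  shows "closedin ProdT {g \<in> topspace ProdT. \<delta> (g x) (g y) = \<delta> x y}"
proof -
  have "continuous_map ProdT (discrete_topology (Ch \<times> Ch)) (\<lambda>g. (g x, g y))"
    unfolding prod_topology_discrete_topology
    using continuous_eval assms by (intro continuous_map_pairedI)
  then have "closedin ProdT {g \<in> topspace ProdT. (g x, g y) \<in> {p \<in> Ch \<times> Ch. \<delta> (fst p) (snd p) = \<delta> x y}}"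
    by (rule closedin_continuous_map_preimage) auto
  moreover have "{g \<in> topspace ProdT. (g x, g y) \<in> {p \<in> Ch \<times> Ch. \<delta> (fst p) (snd p) = \<delta> x y}} =
      {g \<in> topspace ProdT. \<delta> (g x) (g y) = \<delta> x y}"
    using assms by (auto simp: PiE_iff)
  ultimately show ?thesis by simp
qed

lemma closedin_fix:
  assumes "x \<in> Ch"
  shows "closedin ProdT {g \<in> topspace ProdT. g x = x}"
  using closedin_continuous_map_preimage[OF continuous_eval[OF assms], of "{x}"] assms by simp

end

context rooted_building begin

lemma finite_sphere:
  assumes lf: "locally_finite_building W I r Ch \<delta>" and "w \<in> carrier W"
  shows "finite {x \<in> Ch. \<delta> x c = w}"
  using assms(2)
proof (induction "len w" arbitrary: w rule: less_induct)
  case less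
  show ?case
  proof (cases "w = \<one>")
    case True
    then have "{x \<in> Ch. \<delta> x c = w} \<subseteq> {c}" using at_root by auto
    then show ?thesis using finite_subset by blast
  next
    case False
    then obtain k where k: "k \<in> I" "desc k w" using ex_desc less.prems by blast
    have "finite {x \<in> Ch. \<delta> x c = r k \<otimes> w}"
      using less k by (simp add: desc_def)
    moreover have "finite {x. adj k y x}" if "y \<in> Ch" for y
      using lf k that by (simp add: locally_finite_building_def flip: panel_eq)
    ultimately have "finite (\<Union>y\<in>{x \<in> Ch. \<delta> x c = r k \<otimes> w}. {x. adj k y x})" by auto
    moreover have "x \<in> (\<Union>y\<in>{x \<in> Ch. \<delta> x c = r k \<otimes> w}. {x. adj k y x})" if x: "x \<in> Ch" "\<delta> x c = w" for x
    proof -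
      have "w = r k \<otimes> \<delta> (gate k x) c" using dist_gate(1)[of k x] k x by simp
      then have "\<delta> (gate k x) c = r k \<otimes> w" using k x by simp
      moreover have "adj k (gate k x) x" using adj_gate adj_sym k x by blast
      ultimately show ?thesis using adj_in by auto
    qed
    then have "{x \<in> Ch. \<delta> x c = w} \<subseteq> (\<Union>y\<in>{x \<in> Ch. \<delta> x c = r k \<otimes> w}. {x. adj k y x})"
      by blast
    ultimately show ?thesis using finite_subset by blast
  qed
qed

text \<open>
  An automorphism fixing \<open>c\<close> preserves the finite spheres around \<open>c\<close>.  So the fixator is a closed
  subset of a product of finite sets; surjectivity of the limit maps is automatic, because an
  injective map of a finite sphere to itself is onto.
\<close>

lemma compactin_fixator:
  assumes lf: "locally_finite_building W I r Ch \<delta>" and F: "F \<subseteq> Ch" "c \<in> F"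
  shows "compactin AutT (fixator F)"
proof -
  let ?S = "\<lambda>x. {y \<in> Ch. \<delta> y c = \<delta> x c}"
  let ?D = "\<lambda>x y. {g \<in> topspace ProdT. \<delta> (g x) (g y) = \<delta> x y}"
  let ?E = "\<lambda>x. {g \<in> topspace ProdT. g x = x}"
  have eq: "fixator F = (\<Inter>(x, y)\<in>Ch \<times> Ch. ?D x y) \<inter> (\<Inter>x\<in>F. ?E x) \<inter> PiE Ch ?S"
  proof (intro equalityI subsetI)
    fix g assume g: "g \<in> fixator F"
    then have "g \<in> Ch \<rightarrow>\<^sub>E Ch" using auts_subset_PiE fixator_aut by blast
    moreover have "\<delta> (g x) c = \<delta> x c" if "x \<in> Ch" for x
      using aut_dist[OF fixator_aut[OF g] that root_in] fixator_fix[OF g F(2)] by simp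
    ultimately show "g \<in> (\<Inter>(x, y)\<in>Ch \<times> Ch. ?D x y) \<inter> (\<Inter>x\<in>F. ?E x) \<inter> PiE Ch ?S"
      using aut_dist[OF fixator_aut[OF g]] fixator_fix[OF g] by (auto simp: PiE_iff)
  next
    fix g assume g: "g \<in> (\<Inter>(x, y)\<in>Ch \<times> Ch. ?D x y) \<inter> (\<Inter>x\<in>F. ?E x) \<inter> PiE Ch ?S"
    have dist: "\<delta> (g x) (g y) = \<delta> x y" if "x \<in> Ch" "y \<in> Ch" for x y using g that by auto
    have fix_F: "g x = x" if "x \<in> F" for x using g that by auto
    have gS: "g x \<in> ?S x" if "x \<in> Ch" for x using g that by (auto dest: PiE_mem)
    have inj: "inj_on g Ch" using dist gS dist_one_iff by (intro inj_onI) (metis (no_types, lifting) mem_Collect_eq)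
    have "y \<in> g ` Ch" if y: "y \<in> Ch" for y
    proof -
      have "g ` ?S y \<subseteq> ?S y" using gS by auto
      moreover have "finite (?S y)" using finite_sphere[OF lf] y by simp
      moreover have "inj_on g (?S y)" using inj by (rule inj_on_subset) auto
      ultimately have "g ` ?S y = ?S y" by (simp add: endo_inj_surj)
      then show ?thesis using y by blast
    qed
    then have "bij_betw g Ch Ch" using inj gS by (auto simp: bij_betw_def)
    then have "g \<in> Bij Ch" using g by (auto simp: Bij_def PiE_iff)
    then show "g \<in> fixator F" using dist fix_F by (simp add: fixator_def type_pres_auts_def)
  qed
  have "closedin ProdT (\<Inter>(x, y)\<in>Ch \<times> Ch. ?D x y)"
    using closedin_dist_preserving chambers_nonempty by (intro closedin_Inter) auto
  moreover have "closedin ProdT (\<Inter>x\<in>F. ?E x)"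
    using closedin_fix F by (intro closedin_Inter) auto
  moreover have "compactin ProdT (PiE Ch ?S)"
    unfolding compactin_PiE using finite_sphere[OF lf] by (auto simp: compactin_discrete_topology)
  ultimately have "compactin ProdT (fixator F)"
    unfolding eq by (blast intro: closed_Int_compactin closedin_Int)
  then show ?thesis
    using fixator_aut by (auto simp: AutPlus_topology_def compactin_subtopology)
qed

lemma compactin_fixators_product:
  assumes lf: "locally_finite_building W I r Ch \<delta>"
    and F: "F \<subseteq> Ch" "F' \<subseteq> Ch" "F \<union> F' = Ch" "c \<in> F" "c \<in> F'"
  shows "compactin AutT (fixator F <#>\<^bsub>Aut\<^esub> fixator F')"
proof -
  let ?p = "\<lambda>(g, h). \<lambda>x\<in>Ch. if x \<in> F' then g x else h x"
  have cont: "continuous_map (prod_topology ProdT ProdT) ProdT ?p"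
    unfolding continuous_map_componentwise
  proof (intro conjI ballI)
    fix x assume x: "x \<in> Ch"
    have "continuous_map (prod_topology ProdT ProdT) (discrete_topology Ch) (\<lambda>p. fst p x)"
      "continuous_map (prod_topology ProdT ProdT) (discrete_topology Ch) (\<lambda>p. snd p x)"
      using continuous_map_compose[OF continuous_map_fst continuous_eval[OF x]]
        continuous_map_compose[OF continuous_map_snd continuous_eval[OF x]] by (simp_all add: o_def)
    then show "continuous_map (prod_topology ProdT ProdT) (discrete_topology Ch) (\<lambda>p. ?p p x)"
      using x by (cases "x \<in> F'") (simp_all add: case_prod_unfold)
  qed auto
  have comp: "compactin (prod_topology ProdT ProdT) (fixator F \<times> fixator F')"
    using compactin_fixator[OF lf] F
    by (simp add: compactin_Times AutPlus_topology_def compactin_subtopology)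
  have "compactin ProdT (?p ` (fixator F \<times> fixator F'))"
    by (rule image_compactin[OF comp cont])
  moreover have "?p (g, h) = g \<otimes>\<^bsub>Aut\<^esub> h" if "g \<in> fixator F" "h \<in> fixator F'" for g h
    using Bij_imp_extensional[OF aut_Bij[OF mult_aut[OF that[THEN fixator_aut]]]]
      fixators_mult_apply[OF F(1-3) that]
    by (intro extensionalityI[of _ Ch]) auto
  then have "?p ` (fixator F \<times> fixator F') = fixator F <#>\<^bsub>Aut\<^esub> fixator F'"
    by (force simp: set_mult_def image_iff)
  ultimately have "compactin ProdT (fixator F <#>\<^bsub>Aut\<^esub> fixator F')" by simp
  moreover have "fixator F <#>\<^bsub>Aut\<^esub> fixator F' \<subseteq> type_pres_auts Ch \<delta>"
    using fixator_aut by (auto simp: set_mult_def)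
  ultimately show ?thesis by (simp add: AutPlus_topology_def compactin_subtopology)
qed

section \<open>The fixators of wing complements\<close>

text \<open>
  The complement of the wings of type \<open>j\<close>: the chambers whose projection to the \<open>j\<close>-panel of the root
  is the root.
\<close>

definition off_wing :: "'i \<Rightarrow> 'c set" where
  "off_wing j = {x \<in> Ch. \<not> rdesc j (\<delta> x c)}"

lemma off_wing_sub: "off_wing j \<subseteq> Ch" and root_off_wing: "c \<in> off_wing j"
  by (auto simp: off_wing_def)

lemma off_wing_stable:
  assumes "g \<in> type_pres_auts Ch \<delta>" "g c = c" "x \<in> off_wing j"
  shows "g x \<in> off_wing j"
  using aut_dist[OF assms(1), of x c] assms by (auto simp: off_wing_def)

lemma off_wing_conj:
  assumes "g \<in> type_pres_auts Ch \<delta>" "g c = c" "h \<in> fixator (off_wing j)"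
  shows "g \<otimes>\<^bsub>Aut\<^esub> h \<otimes>\<^bsub>Aut\<^esub> inv\<^bsub>Aut\<^esub> g \<in> fixator (off_wing j)"
proof (rule fixator_conj)
  have "(inv\<^bsub>Aut\<^esub> g) c = c" using inv_apply[OF assms(1) root_in] assms(2) by simp
  then show "(inv\<^bsub>Aut\<^esub> g) x \<in> off_wing j" if "x \<in> off_wing j" for x
    using off_wing_stable assms that by simp
qed (use assms off_wing_sub in auto)

lemma locally_normal_wing:
  assumes "locally_finite_building W I r Ch \<delta>"
  shows "locally_normal Aut AutT (fixator (off_wing j))"
  unfolding locally_normal_def
  using subgroup_fixator[OF off_wing_sub] compactin_fixator[OF assms off_wing_sub root_off_wing]
    openin_normalizer[OF root_in _ off_wing_conj] fixator_aut by blast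

lemma off_wings_cover:
  assumes "i \<in> I" "j \<in> I" "i \<noteq> j" "m i j \<noteq> 2"
  shows "off_wing i \<union> off_wing j = Ch"
  using rdesc_commute[OF assms(1-3) root_dist_in] assms(4) by (auto simp: off_wing_def)

lemma locally_normal_wing_product:
  assumes lf: "locally_finite_building W I r Ch \<delta>"
    and ij: "i \<in> I" "j \<in> I" "i \<noteq> j" "m i j \<noteq> 2"
  shows "locally_normal Aut AutT (fixator (off_wing i) <#>\<^bsub>Aut\<^esub> fixator (off_wing j))"
  unfolding locally_normal_def
proof (intro conjI)
  let ?A = "fixator (off_wing i)" and ?B = "fixator (off_wing j)"
  note cover = off_wing_sub off_wing_sub off_wings_cover[OF ij]
  show "subgroup (?A <#>\<^bsub>Aut\<^esub> ?B) Aut"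
    using Aut.subgroup_commuting_product[OF subgroup_fixator[OF off_wing_sub] subgroup_fixator[OF off_wing_sub]]
      fixators_commute[OF cover] by blast
  show "compactin AutT (?A <#>\<^bsub>Aut\<^esub> ?B)"
    by (rule compactin_fixators_product[OF lf cover root_off_wing root_off_wing])
  show "openin AutT (normalizer Aut (?A <#>\<^bsub>Aut\<^esub> ?B))"
  proof (rule openin_normalizer[OF root_in])
    show "?A <#>\<^bsub>Aut\<^esub> ?B \<subseteq> type_pres_auts Ch \<delta>"
      using fixator_aut by (auto simp: set_mult_def)
  next
    fix g h assume g: "g \<in> type_pres_auts Ch \<delta>" "g c = c" and "h \<in> ?A <#>\<^bsub>Aut\<^esub> ?B"
    then obtain a b where h: "a \<in> ?A" "b \<in> ?B" "h = a \<otimes>\<^bsub>Aut\<^esub> b" by (auto simp: set_mult_def)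
    have "g \<otimes>\<^bsub>Aut\<^esub> h \<otimes>\<^bsub>Aut\<^esub> inv\<^bsub>Aut\<^esub> g =
        (g \<otimes>\<^bsub>Aut\<^esub> a \<otimes>\<^bsub>Aut\<^esub> inv\<^bsub>Aut\<^esub> g) \<otimes>\<^bsub>Aut\<^esub> (g \<otimes>\<^bsub>Aut\<^esub> b \<otimes>\<^bsub>Aut\<^esub> inv\<^bsub>Aut\<^esub> g)"
      using g h fixator_aut by (intro aut_eqI) simp_all
    then show "g \<otimes>\<^bsub>Aut\<^esub> h \<otimes>\<^bsub>Aut\<^esub> inv\<^bsub>Aut\<^esub> g \<in> ?A <#>\<^bsub>Aut\<^esub> ?B"
      using Aut.set_mult_memI[OF off_wing_conj[OF g h(1)] off_wing_conj[OF g h(2)]] by simp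
  qed
qed

lemma fixator_wing_nontrivial:
  assumes "semi_regular_building W I r Ch \<delta>" "thick_building W I r Ch \<delta>" "j \<in> I"
  shows "fixator (off_wing j) \<noteq> {\<one>\<^bsub>Aut\<^esub>}"
proof -
  obtain g x where g: "g \<in> type_pres_auts Ch \<delta>" "\<forall>x\<in>Ch. \<not> rdesc j (\<delta> x c) \<longrightarrow> g x = x" "x \<in> Ch" "g x \<noteq> x"
    using ex_wing_automorphism[OF assms] by blast
  then have "g \<in> fixator (off_wing j)" by (auto simp: fixator_def off_wing_def)
  moreover have "g \<noteq> \<one>\<^bsub>Aut\<^esub>" using g by auto
  ultimately show ?thesis by blast
qed

end

text \<open>
  Otherwise a generator \<open>i\<close> commutes with all others, so that by irreducibility it is the only one and
  \<open>W\<close> has order two.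
\<close>

lemma (in right_angled_coxeter_system) ex_nonperp:
  assumes irr: "irreducible_system W I r" and ns: "non_spherical W"
  obtains i j where "i \<in> I" "j \<in> I" "i \<noteq> j" "m i j \<noteq> 2"
proof -
  obtain i where i: "i \<in> I" using irr by (auto simp: irreducible_system_def)
  have "I \<noteq> {i}"
  proof
    assume I: "I = {i}"
    have "val u \<in> {\<one>, r i}" if "u \<in> lists I" for u
      using that by (induction u) (use I gen_sq[OF i] gen_in[OF i] in auto)
    then have "carrier W \<subseteq> {\<one>, r i}" unfolding generated by blast
    then show False using ns finite_subset unfolding non_spherical_def by blast
  qed
  then have "I - {i} \<noteq> {}" using i by blast
  moreover have "I = {i} \<union> (I - {i})" "{i} \<inter> (I - {i}) = {}" using i by auto
  moreover have "{i} \<noteq> {}" by simp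
  ultimately have "\<not> (\<forall>j\<in>{i}. \<forall>k\<in>I - {i}. r j \<otimes> r k = r k \<otimes> r j)"
    using irr unfolding irreducible_system_def by (elim conjE) (rule notI, erule notE, intro exI conjI)
  then obtain j where "j \<in> I" "i \<noteq> j" "r i \<otimes> r j \<noteq> r j \<otimes> r i" by auto
  then show ?thesis using that[of i j] i gen_commute[of i j] by blast
qed

theorem lemma9p1:
  fixes W :: "('w, 'b) monoid_scheme"
    and I :: "'i set"
    and m :: "'i \<Rightarrow> 'i \<Rightarrow> enat"
    and r :: "'i \<Rightarrow> 'w"
    and Ch :: "'c set"
    and \<delta> :: "'c \<Rightarrow> 'c \<Rightarrow> 'w"
  assumes "coxeter_system W I m r"
    and "right_angled I m"
    and "finite I"
    and "building W I m r Ch \<delta>"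
    and "thick_building W I r Ch \<delta>"
    and "semi_regular_building W I r Ch \<delta>"
    and "locally_finite_building W I r Ch \<delta>"
    and "irreducible_system W I r"
    and "non_spherical W"
  shows "\<exists>(K :: ('c \<Rightarrow> 'c) set) (J :: nat set) (H :: nat \<Rightarrow> ('c \<Rightarrow> 'c) set).
    locally_normal (AutPlus Ch \<delta>) (AutPlus_topology Ch \<delta>) K \<and>
    nontrivial_direct_decomposition (AutPlus Ch \<delta>) K J H \<and>
    (\<forall>j\<in>J. locally_normal (AutPlus Ch \<delta>) (AutPlus_topology Ch \<delta>) (H j))"
proof -
  obtain c where c: "c \<in> Ch" using building.chambers_nonempty[OF assms(4)] by blast
  interpret rooted_building W I m r Ch \<delta> c
    using assms(1,2,4) c
    by (simp add: rooted_building_def right_angled_building_def right_angled_coxeter_system_def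
        right_angled_coxeter_system_axioms_def rooted_building_axioms_def)
  obtain i j where ij: "i \<in> I" "j \<in> I" "i \<noteq> j" "m i j \<noteq> 2"
    using ex_nonperp[OF assms(8,9)] by blast
  let ?A = "fixator (off_wing i)" and ?B = "fixator (off_wing j)"
  note cover = off_wing_sub off_wing_sub off_wings_cover[OF ij]
  have "nontrivial_direct_decomposition Aut (?A <#>\<^bsub>Aut\<^esub> ?B) {0, 1 :: nat} (\<lambda>j. if j = 0 then ?A else ?B)"
    by (intro Aut.direct_decomposition_commuting_product subgroup_fixator off_wing_sub
        fixators_commute[OF cover] fixators_Int[OF cover] fixator_wing_nontrivial assms ij)
  moreover have "locally_normal Aut AutT (?A <#>\<^bsub>Aut\<^esub> ?B)"
    by (rule locally_normal_wing_product[OF assms(7) ij])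
  moreover have "\<forall>k\<in>{0, 1 :: nat}. locally_normal Aut AutT (if k = 0 then ?A else ?B)"
    using locally_normal_wing[OF assms(7)] by simp
  ultimately show ?thesis by blast
qed

end
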